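(* Let $R>0$ and suppose that $\mathcal S_{\mathrm{add}}=(\mathcal P_{\mathrm{add}}\mathcal S_*\mathcal P_{\mathrm{add}})|_{\mathcal F_{\mathrm{add}}}$ has a continuous inverse on $\mathcal F_{\mathrm{add}}$. Then $$\mathcal P_{\mathrm{add}}\widehat{\underline r}_R=\mathcal P_{*,R}\widehat{\underline r}_{ll}\qquad\text{and}\qquad(\mathcal I-\mathcal P_{\mathrm{add}})\widehat{\underline r}_R=(\mathcal S_*+R\mathcal I)^{-1}\mathcal S_*(\mathcal I-\mathcal P_{*,R})\widehat{\underline r}_{ll}.$$
   Context: **Data and kernel.** Data $(\underline{\mathbf X}_i,Y_i)\in[0,1]^d\times\mathbb R$, $i=1,\dots,n$; bandwidths $h_1,\dots,h_d>0$. $K\ge0$ is a univariate kernel that is bounded, has compact support, is symmetric about zero and Lipschitz continuous; the product kernel, rescaled at the boundary to satisfy $\int_{[0,1]^d}K_h(\underline{\mathbf X}_i,\underline{\mathbf x})\,d\underline{\mathbf x}=1$, is $$K_h(\underline{\mathbf X}_i,\underline{\mathbf x})=\prod_{k=1}^d \frac{K((X_{i,k}-x_k)/h_k)}{\int_0^1K((X_{i,k}-t)/h_k)\,dt}.$$ **Spaces and operators.** $\mathcal F_{\mathrm{full}}$ is the space of $\underline r=(r^0,\dots,r^d)$ with $r^\ell:[0,1]^d\to\mathbb R$ square integrable, $\|\underline r\|_2^2=\sum_{\ell=0}^d\int r^\ell(\underline{\mathbf x})^2d\underline{\mathbf x}$. $\mathcal F_{\mathrm{add}}\subset\mathcal F_{\mathrm{full}}$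 consists of those $\underline r$ for which $r^0$ is additive (a sum of functions of single coordinates) and, for $k=1,\dots,d$, $r^k(\underline{\mathbf x})$ depends only on $x_k$. $\mathcal P_{\mathrm{add}}$ is the $\|\cdot\|_2$-orthogonal projection onto $\mathcal F_{\mathrm{add}}$; $\mathcal I$ is the identity. With $u_{i,0}(\underline{\mathbf x})=1$, $u_{i,k}(\underline{\mathbf x})=(X_{i,k}-x_k)/h_k$ for $k\ge1$, put $S_{\ell,l}(\underline{\mathbf x})=\frac1n\sum_iK_h(\underline{\mathbf X}_i,\underline{\mathbf x})u_{i,\ell}(\underline{\mathbf x})u_{i,l}(\underline{\mathbf x})$, $L_\ell(\underline{\mathbf x})=\frac1n\sum_iK_h(\underline{\mathbf X}_i,\underline{\mathbf x})u_{i,\ell}(\underline{\mathbf x})Y_i$, $\mathbf S(\underline{\mathbf x})=(S_{\ell,l}(\underline{\mathbf x}))_{\ell,l=0}^d$, $\underline r_L=(L_0,\dots,L_d)$; $\mathcal S_*$ is the pointwise multiplication $(\mathcal S_*\underline r)(\underline{\mathbf x})=\mathbf S(\underline{\mathbf x})\underline r(\underline{\mathbf x})$. **Estimators.** Let $$Q(\underline r)=\int_{[0,1]^d}\frac1n\sum_{i=1}^n\Big[Y_i-r^0(\underline{\mathbf x})-\sum_{k=1}^dr^k(\underline{\mathbf x})\tfrac{X_{i,k}-x_k}{h_k}\Big]^2K_h(\underline{\mathbf X}_i,\underline{\mathbf x})\,d\underline{\mathbf x}.$$ $\widehat{\underline r}_{ll}$ is the local linear estimator, i.e. the minimizer of $Q$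 without restriction, characterized by the normal equations $\mathcal S_*\widehat{\underline r}_{ll}=\underline r_L$ (any solution). $\widehat{\underline r}_R$ is the minimizer over $\mathcal F_{\mathrm{full}}$ of $Q(\underline r)+R\|(\mathcal I-\mathcal P_{\mathrm{add}})\underline r\|_2^2$. **The projection $\mathcal P_{*,R}$.** Let $\Lambda_{*,R}=\mathcal P_{\mathrm{add}}(\mathcal S_*+R\mathcal I)^{-1}\mathcal S_*\mathcal P_{\mathrm{add}}$, regarded as an operator on $\mathcal F_{\mathrm{add}}$ (it has a continuous inverse when $\mathcal S_{\mathrm{add}}$ does), and $$\mathcal P_{*,R}=\mathcal P_{\mathrm{add}}\Lambda_{*,R}^{-1}\mathcal P_{\mathrm{add}}(\mathcal S_*+R\mathcal I)^{-1}\mathcal S_* .$$ Expressions involving $\widehat{\underline r}_{ll}$ depend on it only through $\mathcal S_*\widehat{\underline r}_{ll}=\underline r_L$: $\mathcal P_{*,R}\widehat{\underline r}_{ll}=\Lambda_{*,R}^{-1}\mathcal P_{\mathrm{add}}(\mathcal S_*+R\mathcal I)^{-1}\underline r_L$ and $(\mathcal S_*+R\mathcal I)^{-1}\mathcal S_*(\mathcal I-\mathcal P_{*,R})\widehat{\underline r}_{ll}=(\mathcal S_*+R\mathcal I)^{-1}(\underline r_L-\mathcal S_*\mathcal P_{*,R}\widehat{\underline r}_{ll})$. *)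

theory Defs
  imports "HOL-Analysis.Analysis"
begin

text \<open>
  Tuples of functions \<open>(r\<^sup>0, ..., r\<^sup>d)\<close> on \<open>[0,1]\<^sup>d\<close> are vector-valued functions whose values are
  indexed by \<^typ>\<open>'d option\<close>: \<open>None\<close> is the index 0, \<open>Some k\<close> is the coordinate index \<open>k\<close>.
  Elements of \<open>L\<^sup>2\<close> are represented by functions, and equality in \<open>L\<^sup>2\<close> is \<open>ae_eq\<close>.
\<close>

type_synonym 'd tuple_fun = "real^'d \<Rightarrow> real^('d option)"

abbreviation cube :: "(real^'d::finite) measure" where
  "cube \<equiv> lebesgue_on (cbox 0 1)"

definition ae_eq :: "'d::finite tuple_fun \<Rightarrow> 'd tuple_fun \<Rightarrow> bool" where
  "ae_eq r s \<longleftrightarrow> (AE x in cube. r x = s x)"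

definition F_full :: "('d::finite tuple_fun) set" where
  "F_full = {r. \<forall>l. (\<lambda>x. r x $ l) \<in> borel_measurable cube \<and> integrable cube (\<lambda>x. (r x $ l)\<^sup>2)}"

definition inner2 :: "'d::finite tuple_fun \<Rightarrow> 'd tuple_fun \<Rightarrow> real" where
  "inner2 r s = (\<Sum>l\<in>UNIV. \<integral>x. r x $ l * s x $ l \<partial>cube)"

definition norm2 :: "'d::finite tuple_fun \<Rightarrow> real" where
  "norm2 r = sqrt (\<Sum>l\<in>UNIV. \<integral>x. (r x $ l)\<^sup>2 \<partial>cube)"

definition F_add :: "('d::finite tuple_fun) set" where
  "F_add = {r \<in> F_full.
     (\<exists>g. (\<forall>k. g k \<in> borel_measurable borel) \<and>
          (AE x in cube. r x $ None = (\<Sum>k\<in>UNIV. g k (x $ k)))) \<and>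
     (\<forall>k. \<exists>g. g \<in> borel_measurable borel \<and> (AE x in cube. r x $ Some k = g (x $ k)))}"

definition P_add :: "'d::finite tuple_fun \<Rightarrow> 'd tuple_fun" where
  "P_add r = (SOME p. p \<in> F_add \<and> (\<forall>q\<in>F_add. inner2 (\<lambda>x. r x - p x) q = 0))"

text \<open>Inverse, modulo \<open>ae_eq\<close>, of an operator on the space \<open>F\<close>.\<close>

definition op_inv ::
  "('d::finite tuple_fun) set \<Rightarrow> ('d tuple_fun \<Rightarrow> 'd tuple_fun) \<Rightarrow> 'd tuple_fun \<Rightarrow> 'd tuple_fun" where
  "op_inv F T s = (SOME r. r \<in> F \<and> ae_eq (T r) s)"

definition has_continuous_inverse ::
  "('d::finite tuple_fun) set \<Rightarrow> ('d tuple_fun \<Rightarrow> 'd tuple_fun) \<Rightarrow> bool" where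
  "has_continuous_inverse F T \<longleftrightarrow>
     (\<exists>T'. (\<forall>r\<in>F. T' r \<in> F \<and> ae_eq (T (T' r)) r \<and> ae_eq (T' (T r)) r) \<and>
           (\<forall>r\<in>F. \<forall>e>0. \<exists>\<delta>>0. \<forall>s\<in>F.
              norm2 (\<lambda>x. s x - r x) < \<delta> \<longrightarrow> norm2 (\<lambda>x. T' s x - T' r x) < e))"

definition is_kernel :: "(real \<Rightarrow> real) \<Rightarrow> bool" where
  "is_kernel K \<longleftrightarrow> (\<forall>x. 0 \<le> K x) \<and> bounded (range K) \<and> compact (closure {x. K x \<noteq> 0}) \<and>
     (\<forall>x. K (- x) = K x) \<and> (\<exists>C. C-lipschitz_on UNIV K)"

text \<open>
  If one of the normalizing integrals is 0, then this product kernel is 0 by \<open>x / 0 = 0\<close>;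
  otherwise it integrates to 1 over the cube in its last argument.
\<close>

definition Kh :: "(real \<Rightarrow> real) \<Rightarrow> real^'d::finite \<Rightarrow> real^'d \<Rightarrow> real^'d \<Rightarrow> real" where
  "Kh K h z x = (\<Prod>k\<in>UNIV. K ((z $ k - x $ k) / h $ k) /
                    (\<integral>t. K ((z $ k - t) / h $ k) \<partial>lebesgue_on {0..1}))"

definition u :: "real^'d::finite \<Rightarrow> real^'d \<Rightarrow> 'd option \<Rightarrow> real^'d \<Rightarrow> real" where
  "u h z l x = (case l of None \<Rightarrow> 1 | Some k \<Rightarrow> (z $ k - x $ k) / h $ k)"

definition S_mat ::
  "(real \<Rightarrow> real) \<Rightarrow> real^'d::finite \<Rightarrow> nat \<Rightarrow> (nat \<Rightarrow> real^'d) \<Rightarrow> real^'d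
     \<Rightarrow> real^('d option)^('d option)" where
  "S_mat K h n X x =
     (\<chi> l m. 1 / real n * (\<Sum>i=1..n. Kh K h (X i) x * u h (X i) l x * u h (X i) m x))"

definition r_L ::
  "(real \<Rightarrow> real) \<Rightarrow> real^'d::finite \<Rightarrow> nat \<Rightarrow> (nat \<Rightarrow> real^'d) \<Rightarrow> (nat \<Rightarrow> real) \<Rightarrow> 'd tuple_fun" where
  "r_L K h n X Y x =
     (\<chi> l. 1 / real n * (\<Sum>i=1..n. Kh K h (X i) x * u h (X i) l x * Y i))"

definition S_star ::
  "(real \<Rightarrow> real) \<Rightarrow> real^'d::finite \<Rightarrow> nat \<Rightarrow> (nat \<Rightarrow> real^'d) \<Rightarrow> 'd tuple_fun \<Rightarrow> 'd tuple_fun" where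
  "S_star K h n X r = (\<lambda>x. S_mat K h n X x *v r x)"

definition S_add ::
  "(real \<Rightarrow> real) \<Rightarrow> real^'d::finite \<Rightarrow> nat \<Rightarrow> (nat \<Rightarrow> real^'d) \<Rightarrow> 'd tuple_fun \<Rightarrow> 'd tuple_fun" where
  "S_add K h n X r = P_add (S_star K h n X (P_add r))"

text \<open>\<open>S_res\<close> is the resolvent \<open>(S\<^sub>* + R I)\<^sup>-\<^sup>1\<close>.\<close>

definition S_res ::
  "(real \<Rightarrow> real) \<Rightarrow> real^'d::finite \<Rightarrow> nat \<Rightarrow> (nat \<Rightarrow> real^'d) \<Rightarrow> real
     \<Rightarrow> 'd tuple_fun \<Rightarrow> 'd tuple_fun" where
  "S_res K h n X R = op_inv F_full (\<lambda>r x. S_star K h n X r x + R *\<^sub>R r x)"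

definition Lambda_star ::
  "(real \<Rightarrow> real) \<Rightarrow> real^'d::finite \<Rightarrow> nat \<Rightarrow> (nat \<Rightarrow> real^'d) \<Rightarrow> real
     \<Rightarrow> 'd tuple_fun \<Rightarrow> 'd tuple_fun" where
  "Lambda_star K h n X R r = P_add (S_res K h n X R (S_star K h n X (P_add r)))"

definition P_star ::
  "(real \<Rightarrow> real) \<Rightarrow> real^'d::finite \<Rightarrow> nat \<Rightarrow> (nat \<Rightarrow> real^'d) \<Rightarrow> real
     \<Rightarrow> 'd tuple_fun \<Rightarrow> 'd tuple_fun" where
  "P_star K h n X R r =
     P_add (op_inv F_add (Lambda_star K h n X R) (P_add (S_res K h n X R (S_star K h n X r))))"

definition Q ::
  "(real \<Rightarrow> real) \<Rightarrow> real^'d::finite \<Rightarrow> nat \<Rightarrow> (nat \<Rightarrow> real^'d) \<Rightarrow> (nat \<Rightarrow> real)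
     \<Rightarrow> 'd tuple_fun \<Rightarrow> real" where
  "Q K h n X Y r =
     (\<integral>x. 1 / real n * (\<Sum>i=1..n.
        (Y i - r x $ None - (\<Sum>k\<in>UNIV. r x $ Some k * ((X i $ k - x $ k) / h $ k)))\<^sup>2
          * Kh K h (X i) x) \<partial>cube)"

definition Q_pen ::
  "(real \<Rightarrow> real) \<Rightarrow> real^'d::finite \<Rightarrow> nat \<Rightarrow> (nat \<Rightarrow> real^'d) \<Rightarrow> (nat \<Rightarrow> real) \<Rightarrow> real
     \<Rightarrow> 'd tuple_fun \<Rightarrow> real" where
  "Q_pen K h n X Y R r = Q K h n X Y r + R * (norm2 (\<lambda>x. r x - P_add r x))\<^sup>2"

text \<open>
  The local linear estimator is any solution of the normal equations. It need not be square
  integrable: it enters \<open>P_star\<close> and the composite operators only through \<open>S_star\<close>.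
\<close>

definition is_local_linear ::
  "(real \<Rightarrow> real) \<Rightarrow> real^'d::finite \<Rightarrow> nat \<Rightarrow> (nat \<Rightarrow> real^'d) \<Rightarrow> (nat \<Rightarrow> real)
     \<Rightarrow> 'd tuple_fun \<Rightarrow> bool" where
  "is_local_linear K h n X Y r \<longleftrightarrow> ae_eq (S_star K h n X r) (r_L K h n X Y)"

end

(*
The penalized criterion is a quadratic functional, so its first variation at the minimizer r gives
the normal equation S r + R (r - P r) = r_L almost everywhere, where P is the projection onto the
additive tuples.  With p = P r it reads (S + R)(r - p) = r_L - S p, which is the second claim once
p is identified with P_star r_ll.  Applying P (S + R)^{-1} to (S + R)(r - p) + S p = r_L, and using
P (r - p) = 0, gives Lambda p = P (S + R)^{-1} r_L.  So it suffices that Lambda is injective on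
additive tuples: if z = (S + R)^{-1} S d, then |z|^2 <= <z, d> pointwise since S is positive
semidefinite, hence P z = 0 for additive d forces z = 0 and S d = 0, and then d = 0 by the
invertibility of S_add.

The existence of P is obtained from an explicit formula: with E_k f the average of f over all
coordinates but the k-th, f projects to sum_k E_k f - (d - 1) E f.  All Fubini arguments go through
the single fact that resampling one coordinate of a uniform point of the cube by an independent
uniform number preserves the uniform distribution.
*)
theory Submission imports Defs begin

subsection \<open>Square integrable functions\<close>

text \<open>One notion for scalar and vector values: the closure properties below serve single
  components as well as whole tuples, where \<open>F_full\<close> is \<open>sq_int cube\<close> (see
  \<open>F_full_iff\<close>).\<close>

definition sq_int :: "'a measure \<Rightarrow> ('a \<Rightarrow> 'b::euclidean_space) \<Rightarrow> bool" where
  "sq_int M f \<longleftrightarrow> f \<in> borel_measurable M \<and> integrable M (\<lambda>x. (norm (f x))\<^sup>2)"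

lemma sq_int_real_iff:
  "sq_int M f \<longleftrightarrow> f \<in> borel_measurable M \<and> integrable M (\<lambda>x. (f x)\<^sup>2)" for f :: "'a \<Rightarrow> real"
  by (simp add: sq_int_def)

lemma sq_int_bound:
  assumes "sq_int M f" "g \<in> borel_measurable M" "AE x in M. norm (g x) \<le> c * norm (f x)"
  shows "sq_int M g"
proof -
  have "integrable M (\<lambda>x. c\<^sup>2 * (norm (f x))\<^sup>2)"
    using assms(1) by (simp add: sq_int_def)
  moreover have "AE x in M. norm ((norm (g x))\<^sup>2) \<le> norm (c\<^sup>2 * (norm (f x))\<^sup>2)"
    using assms(3)
  proof eventually_elim
    case (elim x)
    then have "(norm (g x))\<^sup>2 \<le> (c * norm (f x))\<^sup>2"
      by (intro power_mono) auto
    then show ?case by (simp add: power_mult_distrib)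
  qed
  ultimately have "integrable M (\<lambda>x. (norm (g x))\<^sup>2)"
    using assms(2)
    by (elim Bochner_Integration.integrable_bound[of M "\<lambda>x. c\<^sup>2 * (norm (f x))\<^sup>2"]) simp_all
  with assms(2) show ?thesis by (simp add: sq_int_def)
qed

lemma sq_int_add:
  assumes "sq_int M f" "sq_int M g"
  shows "sq_int M (\<lambda>x. f x + g x)"
proof -
  have meas: "f \<in> borel_measurable M" "g \<in> borel_measurable M"
    using assms by (simp_all add: sq_int_def)
  have "integrable M (\<lambda>x. 2 * (norm (f x))\<^sup>2 + 2 * (norm (g x))\<^sup>2)"
    using assms by (simp add: sq_int_def)
  moreover have "AE x in M. norm ((norm (f x + g x))\<^sup>2)
      \<le> norm (2 * (norm (f x))\<^sup>2 + 2 * (norm (g x))\<^sup>2)"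
  proof (rule AE_I2)
    fix x
    have "(norm (f x + g x))\<^sup>2 \<le> (norm (f x) + norm (g x))\<^sup>2"
      by (intro power_mono norm_triangle_ineq) auto
    also have "\<dots> \<le> 2 * (norm (f x))\<^sup>2 + 2 * (norm (g x))\<^sup>2"
      using sum_squares_bound[of "norm (f x)" "norm (g x)"] by (simp add: power2_sum)
    finally show "norm ((norm (f x + g x))\<^sup>2) \<le> norm (2 * (norm (f x))\<^sup>2 + 2 * (norm (g x))\<^sup>2)"
      by simp
  qed
  ultimately have "integrable M (\<lambda>x. (norm (f x + g x))\<^sup>2)"
    using meas
    by (elim Bochner_Integration.integrable_bound[of M "\<lambda>x. 2 * (norm (f x))\<^sup>2 + 2 * (norm (g x))\<^sup>2"])
      simp_all
  with meas show ?thesis by (simp add: sq_int_def)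
qed

lemma sq_int_scaleR: 
  assumes "sq_int M f"
  shows "sq_int M (\<lambda>x. c *\<^sub>R f x)"
  using assms by (intro sq_int_bound[OF assms, where c = "\<bar>c\<bar>"]) (auto simp: sq_int_def)

lemma sq_int_diff:
  assumes "sq_int M f" "sq_int M g"
  shows "sq_int M (\<lambda>x. f x - g x)"
  using sq_int_add[OF assms(1) sq_int_scaleR[OF assms(2), of "-1"]] by simp

lemma sq_int_zero: "sq_int M (\<lambda>x. 0)"
  by (simp add: sq_int_def)

lemma sq_int_sum: "(\<And>i. i \<in> I \<Longrightarrow> sq_int M (f i)) \<Longrightarrow> sq_int M (\<lambda>x. \<Sum>i\<in>I. f i x)"
  by (induction I rule: infinite_finite_induct) (auto intro: sq_int_add sq_int_zero)

lemma sq_int_const: "finite_measure M \<Longrightarrow> sq_int M (\<lambda>x. c)"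
  by (simp add: sq_int_def finite_measure.integrable_const)

lemma sq_int_cong_AE:
  assumes "sq_int M f" "g \<in> borel_measurable M" "AE x in M. f x = g x"
  shows "sq_int M g"
  using assms(3) by (intro sq_int_bound[OF assms(1,2), of 1]) auto

lemma sq_int_integrable_inner:
  assumes "sq_int M f" "sq_int M g"
  shows "integrable M (\<lambda>x. f x \<bullet> g x)"
proof (rule Bochner_Integration.integrable_bound)
  show "integrable M (\<lambda>x. (norm (f x))\<^sup>2 + (norm (g x))\<^sup>2)"
    using assms by (simp add: sq_int_def)
  show "(\<lambda>x. f x \<bullet> g x) \<in> borel_measurable M"
    using assms by (intro borel_measurable_inner) (simp_all add: sq_int_def)
  show "AE x in M. norm (f x \<bullet> g x) \<le> norm ((norm (f x))\<^sup>2 + (norm (g x))\<^sup>2)"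
  proof (rule AE_I2)
    fix x
    have nonneg: "0 \<le> norm (f x) * norm (g x)" by simp
    have "\<bar>f x \<bullet> g x\<bar> \<le> norm (f x) * norm (g x)" by (rule Cauchy_Schwarz_ineq2)
    also have "\<dots> \<le> (norm (f x))\<^sup>2 + (norm (g x))\<^sup>2"
      using sum_squares_bound[of "norm (f x)" "norm (g x)"] nonneg by linarith
    finally show "norm (f x \<bullet> g x) \<le> norm ((norm (f x))\<^sup>2 + (norm (g x))\<^sup>2)" by simp
  qed
qed

lemma sq_int_integrable_mult:
  "sq_int M f \<Longrightarrow> sq_int M g \<Longrightarrow> integrable M (\<lambda>x. f x * g x)" for f g :: "'a \<Rightarrow> real"
  using sq_int_integrable_inner[of M f g] by simp

lemma sq_int_integrable:
  "finite_measure M \<Longrightarrow> sq_int M f \<Longrightarrow> integrable M f" for f :: "'a \<Rightarrow> real"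
  using sq_int_integrable_mult[of M f "\<lambda>x. 1"] sq_int_const[of M "1::real"] by simp

text \<open>Nonnegativity of the variance on a probability space.\<close>

lemma sq_int_integral_power2_le:
  fixes f :: "'a \<Rightarrow> real"
  assumes "finite_measure M" "measure M (space M) = 1" "sq_int M f"
  shows "(\<integral>x. f x \<partial>M)\<^sup>2 \<le> (\<integral>x. (f x)\<^sup>2 \<partial>M)"
proof -
  define m where "m = (\<integral>x. f x \<partial>M)"
  interpret finite_measure M by fact
  have [simp]: "integrable M f" "integrable M (\<lambda>x. (f x)\<^sup>2)"
    using assms sq_int_integrable by (auto simp: sq_int_def)
  have "0 \<le> (\<integral>x. (f x - m)\<^sup>2 \<partial>M)" by simp
  also have "\<dots> = (\<integral>x. (f x)\<^sup>2 + m\<^sup>2 - 2 * m * f x \<partial>M)"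
    by (simp add: power2_diff algebra_simps)
  also have "\<dots> = (\<integral>x. (f x)\<^sup>2 \<partial>M) + m\<^sup>2 - 2 * m * m"
    by (simp add: assms(2) m_def)
  finally show ?thesis unfolding m_def by (simp add: power2_eq_square)
qed

section \<open>Measurability and square integrability by components\<close>

lemma borel_measurable_vec_nth [measurable]:
  "(\<lambda>x. x $ j) \<in> borel_measurable (borel :: (real^'d) measure)"
  by (intro borel_measurable_continuous_onI continuous_intros)

lemma borel_measurable_vec_iff:
  fixes f :: "'a \<Rightarrow> real^'d"
  shows "f \<in> borel_measurable M \<longleftrightarrow> (\<forall>j. (\<lambda>x. f x $ j) \<in> borel_measurable M)"
proof
  show "\<forall>j. (\<lambda>x. f x $ j) \<in> borel_measurable M" if [measurable]: "f \<in> borel_measurable M"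
    by measurable
next
  assume *: "\<forall>j. (\<lambda>x. f x $ j) \<in> borel_measurable M"
  show "f \<in> borel_measurable M"
  proof (subst borel_measurable_euclidean_space, rule ballI)
    fix b :: "real^'d" assume "b \<in> Basis"
    then obtain j where "b = axis j 1" by (auto simp: Basis_vec_def)
    with * show "(\<lambda>x. f x \<bullet> b) \<in> borel_measurable M"
      by (simp add: inner_axis)
  qed
qed

lemma sq_int_vec_iff:
  fixes f :: "'a \<Rightarrow> real^'n"
  shows "sq_int M f \<longleftrightarrow> (\<forall>i. sq_int M (\<lambda>x. f x $ i))"
proof
  assume f: "sq_int M f"
  have "f \<in> borel_measurable M" using f by (simp add: sq_int_def)
  then have "(\<lambda>x. f x $ i) \<in> borel_measurable M" for i
    by (simp add: borel_measurable_vec_iff)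
  then show "\<forall>i. sq_int M (\<lambda>x. f x $ i)"
    by (auto intro!: sq_int_bound[OF f, where c = 1] simp: component_le_norm_cart)
next
  assume *: "\<forall>i. sq_int M (\<lambda>x. f x $ i)"
  then have "f \<in> borel_measurable M"
    by (simp add: borel_measurable_vec_iff sq_int_def)
  moreover have "integrable M (\<lambda>x. (norm (f x))\<^sup>2)"
    using * by (simp add: sq_int_def norm_vec_def L2_set_def sum_nonneg)
  ultimately show "sq_int M f" by (simp add: sq_int_def)
qed

subsection \<open>Resampling one coordinate of a uniform point\<close>

text \<open>
  Keeps \<open>cbox 0 1\<close> in \<open>unif :: real measure\<close> from being rewritten to \<open>{0..1}\<close>, which would hide
  \<open>unif\<close> from the lemmas about it.
\<close>

declare box_real [simp del]

text \<open>Unlike \<open>cube\<close>, this is a measure on the Borel sets of the whole space and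
  is not completed, so products, image measures and Fubini need Borel measurability only.\<close>

abbreviation unif :: "'a::{euclidean_space, one} measure" where
  "unif \<equiv> density lborel (indicator (cbox 0 1))"

section \<open>The uniform law and its distribution function\<close>

lemma emeasure_unif: "A \<in> sets borel \<Longrightarrow> emeasure unif A = emeasure lborel (cbox 0 1 \<inter> A)"
  by (simp add: emeasure_density flip: indicator_inter_arith)

lemma finite_measure_unif: "finite_measure (unif :: 'a::{euclidean_space, one} measure)"
  by (rule finite_measureI) (simp add: emeasure_unif emeasure_lborel_cbox_eq)

text \<open>The distribution function is computed because lower orthants are the generator on which
  \<open>distr_upd\<close> compares two measures. The clamps \<open>max 0 (min 1 _)\<close> account
  for corners outside the cube.\<close>

lemma measure_unif_atMost:
  fixes a :: "real^'d"
  shows "measure unif {..a} = (\<Prod>j\<in>UNIV. max 0 (min 1 (a $ j)))"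
proof -
  have eq: "cbox 0 1 \<inter> {..a} = cbox 0 (\<chi> j. min 1 (a $ j))"
    by (auto simp: mem_box_cart less_eq_vec_def)
  have "measure unif {..a} = measure lborel (cbox 0 (\<chi> j. min 1 (a $ j)))"
    by (simp add: measure_def emeasure_unif eq)
  also have "\<dots> = (\<Prod>j\<in>UNIV. max 0 (min 1 (a $ j)))"
  proof (cases "\<forall>j. 0 \<le> a $ j")
    case True
    then have "cbox 0 (\<chi> j. min 1 (a $ j)) \<noteq> {}"
      by (auto simp: interval_ne_empty_cart)
    then show ?thesis using True by (simp add: content_cbox_cart max_def)
  next
    case False
    then obtain j where j: "a $ j < 0" by (auto simp: not_le)
    then have "cbox 0 (\<chi> j. min 1 (a $ j)) = {}"
      by (auto simp: interval_eq_empty_cart intro!: exI[of _ j])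
    moreover have "(\<Prod>j\<in>UNIV. max 0 (min 1 (a $ j))) = 0"
      using j by (auto intro!: prod_zero bexI[of _ j] exI[of _ j])
    ultimately show ?thesis by simp
  qed
  finally show ?thesis .
qed

lemma measure_unif_atMost_real: "measure unif {..a} = max 0 (min 1 a)" for a :: real
proof -
  have "measure unif {..a} = measure lborel (cbox 0 1 \<inter> {..a})"
    by (simp add: measure_def emeasure_unif)
  also have "cbox 0 1 \<inter> {..a} = {0..min 1 a}" by auto
  finally show ?thesis by auto
qed

lemma measure_unif_space: "measure (unif :: (real^'d) measure) UNIV = 1"
proof -
  have "measure (unif :: (real^'d) measure) UNIV = measure lborel (cbox 0 1 :: (real^'d) set)"
    by (simp add: measure_def emeasure_unif)
  also have "\<dots> = 1" by (simp add: content_cbox_cart interval_ne_empty_cart)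
  finally show ?thesis .
qed

lemma measure_unif_space_real: "measure (unif :: real measure) UNIV = 1"
proof -
  have "measure (unif :: real measure) UNIV = measure lborel (cbox 0 1 :: real set)"
    by (simp add: measure_def emeasure_unif)
  then show ?thesis by (simp add: box_real)
qed

definition upd :: "'d \<Rightarrow> real^'d \<Rightarrow> real \<Rightarrow> real^'d" where
  "upd k x t = (\<chi> j. if j = k then t else x $ j)"

lemma upd_nth: "upd k x t $ j = (if j = k then t else x $ j)"
  by (simp add: upd_def)

lemma upd_le_iff: "upd k x t \<le> a \<longleftrightarrow> (\<forall>j. j \<noteq> k \<longrightarrow> x $ j \<le> a $ j) \<and> t \<le> a $ k"
  unfolding less_eq_vec_def upd_nth by metis

lemma measurable_upd [measurable]:
  "(\<lambda>(x, t). upd k x t) \<in> borel_measurable (borel \<Otimes>\<^sub>M borel)"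
  by (simp add: borel_measurable_vec_iff upd_nth split_beta)

text \<open>Both measures are finite, so it suffices that they agree on the intersection-stable
  family of orthants \<open>{..a}\<close>. There the event splits into a condition on the old
  coordinates other than \<open>k\<close> and one on the fresh coordinate, and the distribution
  function factorizes accordingly.\<close>

lemma distr_upd:
  "distr (unif \<Otimes>\<^sub>M unif) borel (\<lambda>(x, t). upd k x t) = (unif :: (real^'d) measure)"
proof (rule measure_eqI_generator_eq[where E = "range atMost" and \<Omega> = UNIV and A = "\<lambda>n. {..\<chi> j. real n}"])
  interpret U: finite_measure "unif :: real measure" by (rule finite_measure_unif)
  interpret V: finite_measure "unif :: (real^'d) measure" by (rule finite_measure_unif)
  show "Int_stable (range (atMost :: real^'d \<Rightarrow> _))"
  proof (rule Int_stableI, clarsimp)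
    fix a b :: "real^'d"
    have "{..a} \<inter> {..b} = {..\<chi> j. min (a $ j) (b $ j)}"
      by (auto simp: less_eq_vec_def)
    then show "{..a} \<inter> {..b} \<in> range atMost" by blast
  qed
  show "sets (distr (unif \<Otimes>\<^sub>M unif) borel (\<lambda>(x, t). upd k x t)) = sigma_sets UNIV (range atMost)"
    "sets (unif :: (real^'d) measure) = sigma_sets UNIV (range atMost)"
    by (simp_all add: borel_eq_atMost)
  show "(\<Union>n. {..\<chi> j. real n}) = (UNIV :: (real^'d) set)"
  proof safe
    fix x :: "real^'d"
    obtain n where "norm x \<le> real n" using real_arch_simple by blast
    then have "x $ j \<le> real n" for j
      using component_le_norm_cart[of x j] by linarith
    then have "x \<in> {..\<chi> j. real n}" by (simp add: less_eq_vec_def)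
    then show "x \<in> (\<Union>n. {..\<chi> j. real n})" by blast
  qed auto
  show "emeasure (distr (unif \<Otimes>\<^sub>M unif) borel (\<lambda>(x, t). upd k x t)) A = emeasure unif A"
    if A_range: "A \<in> range atMost" for A
  proof -
    obtain a where A: "A = {..a}" using A_range by blast
    define B where "B = {x::real^'d. \<forall>j. j \<noteq> k \<longrightarrow> x $ j \<le> a $ j}"
    have B [measurable]: "B \<in> sets borel" unfolding B_def by measurable
    have "(\<lambda>(x, t). upd k x t) -` A \<inter> space (unif \<Otimes>\<^sub>M unif) = B \<times> {..a $ k}"
      unfolding A B_def by (auto simp: upd_le_iff space_pair_measure)
    then have "emeasure (distr (unif \<Otimes>\<^sub>M unif) borel (\<lambda>(x, t). upd k x t)) A
        = emeasure unif B * emeasure unif {..a $ k}"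
      by (subst emeasure_distr) (auto simp: A U.emeasure_pair_measure_Times)
    \<comment> \<open>\<open>B\<close> leaves coordinate \<open>k\<close> free. Within the cube this
      is the same as bounding that coordinate by 1, which turns \<open>B\<close> into an
      orthant.\<close>
    also have "emeasure unif B = emeasure unif {..upd k a 1}"
    proof -
      have "cbox 0 1 \<inter> B = cbox 0 1 \<inter> {..upd k a 1}"
        unfolding B_def
        by (fastforce simp: mem_box_cart less_eq_vec_def upd_nth split: if_splits)
      then show ?thesis by (simp add: emeasure_unif)
    qed
    also have "emeasure unif {..upd k a 1} * emeasure unif {..a $ k} = emeasure unif A"
    proof -
      \<comment> \<open>Factor \<open>k\<close> of the first product is 1; the factor of the fresh
        coordinate takes its place.\<close>
      have "(\<Prod>j\<in>UNIV. max 0 (min 1 (upd k a 1 $ j))) * max 0 (min 1 (a $ k))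
          = (\<Prod>j\<in>UNIV. max 0 (min 1 (a $ j)))"
        by (simp add: prod.remove[of UNIV k] upd_nth)
      then show ?thesis
        unfolding U.emeasure_eq_measure V.emeasure_eq_measure A
        by (simp add: measure_unif_atMost measure_unif_atMost_real prod_nonneg flip: ennreal_mult)
    qed
    finally show ?thesis .
  qed
  show "emeasure (distr (unif \<Otimes>\<^sub>M unif) borel (\<lambda>(x, t). upd k x t)) {..\<chi> j. real n} \<noteq> \<infinity>" for n
  proof -
    interpret P: pair_sigma_finite "unif :: (real^'d) measure" "unif :: real measure" ..
    have "finite_measure (unif \<Otimes>\<^sub>M unif :: ((real^'d) \<times> real) measure)"
      by (rule finite_measure_pair_measure) (rule finite_measure_unif)+
    then interpret W: finite_measure "unif \<Otimes>\<^sub>M unif :: ((real^'d) \<times> real) measure" .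
    show ?thesis by (subst emeasure_distr) auto
  qed
qed auto

lemma pair_sigma_finite_unif:
  "pair_sigma_finite (unif :: (real^'d) measure) (unif :: real measure)"
  by (intro pair_sigma_finite.intro finite_measure.axioms(1) finite_measure_unif)

text \<open>Change of variables along \<open>distr_upd\<close>, then Fubini for the pair of the
  point and the fresh coordinate. This replaces a decomposition of the cube into coordinate
  \<open>k\<close> and the remaining ones.\<close>

lemma
  fixes f :: "real^'d \<Rightarrow> real"
  assumes f: "integrable unif f"
  shows integrable_upd: "integrable (unif \<Otimes>\<^sub>M unif) (\<lambda>(x, t). f (upd k x t))"
    and integral_upd: "(\<integral>t. \<integral>x. f (upd k x t) \<partial>unif \<partial>unif) = (\<integral>x. f x \<partial>unif)"
proof -
  have [measurable]: "f \<in> borel_measurable borel"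
    using borel_measurable_integrable[OF f] by simp
  have "integrable (distr (unif \<Otimes>\<^sub>M unif) borel (\<lambda>(x, t). upd k x t)) f"
    using f by (simp add: distr_upd)
  then show *: "integrable (unif \<Otimes>\<^sub>M unif) (\<lambda>(x, t). f (upd k x t))"
    by (subst (asm) integrable_distr_eq) (simp_all add: case_prod_unfold)
  have "(\<integral>x. f x \<partial>unif) = (\<integral>x. f x \<partial>distr (unif \<Otimes>\<^sub>M unif) borel (\<lambda>(x, t). upd k x t))"
    by (simp add: distr_upd)
  also have "\<dots> = (\<integral>(x, t). f (upd k x t) \<partial>(unif \<Otimes>\<^sub>M unif))"
    by (subst integral_distr) (simp_all add: case_prod_unfold)
  also have "\<dots> = (\<integral>t. \<integral>x. f (upd k x t) \<partial>unif \<partial>unif)"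
    using pair_sigma_finite.integral_snd[OF pair_sigma_finite_unif *] by simp
  finally show "(\<integral>t. \<integral>x. f (upd k x t) \<partial>unif \<partial>unif) = (\<integral>x. f x \<partial>unif)" by simp
qed

text \<open>After resampling, coordinate \<open>k\<close> is the fresh uniform number, so the
  preimage of \<open>A\<close> is \<open>UNIV \<times> A\<close>.\<close>

lemma distr_vec_nth: "distr unif borel (\<lambda>x::real^'d. x $ k) = unif"
proof (rule measure_eqI)
  fix A assume "A \<in> sets (distr unif borel (\<lambda>x::real^'d. x $ k))"
  then have A [measurable]: "A \<in> sets borel" by simp
  interpret U: finite_measure "unif :: real measure" by (rule finite_measure_unif)
  interpret V: finite_measure "unif :: (real^'d) measure" by (rule finite_measure_unif)
  have "emeasure (distr unif borel (\<lambda>x::real^'d. x $ k)) A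
      = emeasure (distr (unif \<Otimes>\<^sub>M unif) borel (\<lambda>(x, t). upd k x t)) {x. x $ k \<in> A}"
    by (simp add: emeasure_distr distr_upd vimage_def)
  also have "\<dots> = emeasure (unif \<Otimes>\<^sub>M unif) ((UNIV :: (real^'d) set) \<times> A)"
  proof (subst emeasure_distr)
    have "(\<lambda>(x, t). upd k x t) -` {x::real^'d. x $ k \<in> A} \<inter> space (unif \<Otimes>\<^sub>M unif) = UNIV \<times> A"
      by (auto simp: upd_nth space_pair_measure)
    then show "emeasure (unif \<Otimes>\<^sub>M unif) ((\<lambda>(x, t). upd k x t) -` {x::real^'d. x $ k \<in> A} \<inter> space (unif \<Otimes>\<^sub>M unif))
        = emeasure (unif \<Otimes>\<^sub>M unif) ((UNIV :: (real^'d) set) \<times> A)" by simp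
  qed simp_all
  also have "\<dots> = emeasure unif A"
    by (subst U.emeasure_pair_measure_Times) (simp_all add: V.emeasure_eq_measure measure_unif_space)
  finally show "emeasure (distr unif borel (\<lambda>x::real^'d. x $ k)) A = emeasure unif A" .
qed simp

lemma integral_unif_vec_nth:
  fixes a :: "real \<Rightarrow> real"
  assumes [measurable]: "a \<in> borel_measurable borel"
  shows "(\<integral>x. a (x $ k) \<partial>(unif :: (real^'d) measure)) = (\<integral>t. a t \<partial>unif)"
  by (subst distr_vec_nth[symmetric, of k]) (simp add: integral_distr)

lemma sq_int_unif_vec_nth:
  fixes a :: "real \<Rightarrow> real"
  assumes "sq_int unif a"
  shows "sq_int (unif :: (real^'d) measure) (\<lambda>x. a (x $ k))"
proof -
  have [measurable]: "a \<in> borel_measurable borel" using assms by (simp add: sq_int_def)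
  have "integrable (distr unif borel (\<lambda>x::real^'d. x $ k)) (\<lambda>t. (a t)\<^sup>2)"
    using assms by (simp add: sq_int_real_iff distr_vec_nth)
  then show ?thesis
    by (subst (asm) integrable_distr_eq) (simp_all add: sq_int_real_iff)
qed

section \<open>Conditional expectation given one coordinate\<close>

definition condE :: "'d \<Rightarrow> (real^'d \<Rightarrow> real) \<Rightarrow> real \<Rightarrow> real" where
  "condE k f t = (\<integral>x. f (upd k x t) \<partial>unif)"

text \<open>The square of the average over a slice is at most the average of the square, and the
  latter is integrable in \<open>t\<close> by Fubini.\<close>

lemma sq_int_condE:
  fixes f :: "real^'d \<Rightarrow> real"
  assumes f: "sq_int unif f"
  shows "sq_int unif (condE k f)"
proof -
  interpret V: finite_measure "unif :: (real^'d) measure" by (rule finite_measure_unif)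
  interpret P: pair_sigma_finite "unif :: (real^'d) measure" "unif :: real measure"
    by (rule pair_sigma_finite_unif)
  have [measurable]: "f \<in> borel_measurable borel" using f by (simp add: sq_int_def)
  have meas: "(\<lambda>(t, x). f (upd k x t)) \<in> borel_measurable (borel \<Otimes>\<^sub>M borel)"
    by measurable
  have condE: "condE k f \<in> borel_measurable unif"
    unfolding condE_def using meas by (intro V.borel_measurable_lebesgue_integral) simp
  have *: "integrable (unif \<Otimes>\<^sub>M unif) (\<lambda>(x, t). (f (upd k x t))\<^sup>2)"
    using f by (intro integrable_upd[of "\<lambda>x. (f x)\<^sup>2"]) (simp add: sq_int_real_iff)
  have "integrable unif (\<lambda>t. (condE k f t)\<^sup>2)"
  proof (rule Bochner_Integration.integrable_bound)
    show "integrable unif (\<lambda>t. \<integral>x. (f (upd k x t))\<^sup>2 \<partial>unif)"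
      using P.integrable_snd[OF *] .
    show "(\<lambda>t. (condE k f t)\<^sup>2) \<in> borel_measurable unif" using condE by measurable
    show "AE t in unif. norm ((condE k f t)\<^sup>2) \<le> norm (\<integral>x. (f (upd k x t))\<^sup>2 \<partial>unif)"
      \<comment> \<open>The comparison holds only for those \<open>t\<close> whose slice is square
        integrable, which is almost every \<open>t\<close>.\<close>
      using P.AE_integrable_snd[OF *]
    proof eventually_elim
      case (elim t)
      have "(\<lambda>x. f (upd k x t)) \<in> borel_measurable unif"
        using measurable_Pair2[OF meas, of t] by (simp add: split_beta)
      with elim have "sq_int unif (\<lambda>x. f (upd k x t))" by (simp add: sq_int_real_iff)
      from sq_int_integral_power2_le[OF finite_measure_unif _ this]
      show ?case by (simp add: condE_def measure_unif_space)
    qed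
  qed
  with condE show ?thesis by (simp add: sq_int_real_iff)
qed

text \<open>The defining property of a conditional expectation. Resampling coordinate
  \<open>k\<close> turns \<open>g (x $ k)\<close> into \<open>g t\<close>, a constant in the inner
  integral.\<close>

lemma integral_mult_vec_nth:
  fixes f :: "real^'d \<Rightarrow> real"
  assumes f: "sq_int unif f" and g: "sq_int unif g"
  shows "(\<integral>x. f x * g (x $ k) \<partial>unif) = (\<integral>t. condE k f t * g t \<partial>unif)"
  using integral_upd[OF sq_int_integrable_mult[OF f sq_int_unif_vec_nth[OF g]], of k k]
  by (simp add: upd_nth condE_def)

lemma integral_condE:
  fixes f :: "real^'d \<Rightarrow> real"
  assumes f: "sq_int unif f"
  shows "(\<integral>t. condE k f t \<partial>unif) = (\<integral>x. f x \<partial>unif)"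
  using integral_mult_vec_nth[OF f sq_int_const[OF finite_measure_unif], of 1 k] by simp

text \<open>Independence of distinct coordinates: averaging \<open>a (x $ j)\<close> with coordinate
  \<open>k\<close> overwritten does not depend on the value written there.\<close>

lemma integral_mult_vec_nth_indep:
  fixes a b :: "real \<Rightarrow> real"
  assumes a: "sq_int unif a" and b: "sq_int unif b" and "j \<noteq> k"
  shows "(\<integral>x. a (x $ j) * b (x $ k) \<partial>(unif :: (real^'d) measure)) = (\<integral>t. a t \<partial>unif) * (\<integral>t. b t \<partial>unif)"
proof -
  have "condE k (\<lambda>x::real^'d. a (x $ j)) = (\<lambda>t. \<integral>t. a t \<partial>unif)"
    using assms by (simp add: condE_def upd_nth integral_unif_vec_nth sq_int_def fun_eq_iff)
  then show ?thesis
    by (simp add: integral_mult_vec_nth[OF sq_int_unif_vec_nth[OF a] b])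
qed

text \<open>\<open>F_add\<close> asks only for a square integrable sum of measurable functions. By
  Fubini there is a point \<open>x\<close> along whose line in direction \<open>k\<close> the sum is
  square integrable in \<open>t\<close>; on that line all summands but the one for \<open>k\<close>
  are constant.\<close>

lemma sq_int_summand:
  fixes g :: "'d::finite \<Rightarrow> real \<Rightarrow> real"
  assumes s: "sq_int (unif :: (real^'d) measure) (\<lambda>x. \<Sum>k\<in>UNIV. g k (x $ k))"
    and [measurable]: "\<And>k. g k \<in> borel_measurable borel"
  shows "sq_int unif (g k)"
proof -
  interpret V: finite_measure "unif :: (real^'d) measure" by (rule finite_measure_unif)
  interpret P: pair_sigma_finite "unif :: (real^'d) measure" "unif :: real measure"
    by (rule pair_sigma_finite_unif)
  have "integrable (unif \<Otimes>\<^sub>M unif) (\<lambda>(x, t). (\<Sum>j\<in>UNIV. g j (upd k x t $ j))\<^sup>2)"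
    using s by (intro integrable_upd[of "\<lambda>x. (\<Sum>j\<in>UNIV. g j (x $ j))\<^sup>2"]) (simp add: sq_int_real_iff)
  from P.AE_integrable_fst[OF this]
  have "AE x in unif. integrable unif (\<lambda>t. (\<Sum>j\<in>UNIV. g j (upd k x t $ j))\<^sup>2)" .
  \<comment> \<open>The total mass is 1, so a property valid almost everywhere holds at some
    point.\<close>
  moreover have "\<not> (AE x::real^'d in unif. False)"
    using V.emeasure_eq_measure[of UNIV] by (simp add: trivial_limit_def[symmetric] ae_filter_eq_bot_iff measure_unif_space)
  ultimately obtain x where x: "integrable unif (\<lambda>t. (\<Sum>j\<in>UNIV. g j (upd k x t $ j))\<^sup>2)"
    by (metis (mono_tags, lifting) eventually_mono)
  define c where "c = (\<Sum>j\<in>UNIV - {k}. g j (x $ j))"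
  have "(\<Sum>j\<in>UNIV. g j (upd k x t $ j)) = g k t + c" for t
    by (simp add: sum.remove[of UNIV k] upd_nth c_def)
  with x have "sq_int unif (\<lambda>t. g k t + c)" by (simp add: sq_int_real_iff)
  from sq_int_diff[OF this sq_int_const[OF finite_measure_unif, of c]] show ?thesis by simp
qed

text \<open>
  The constant \<open>(d - 1) * \<integral>f\<close> of the projection is distributed evenly over the \<open>d\<close> summands, so that
  \<open>\<Sum>k. add_part f k (x $ k)\<close> is the additive part of \<open>f\<close>.
\<close>

definition add_part :: "(real^'d \<Rightarrow> real) \<Rightarrow> 'd \<Rightarrow> real \<Rightarrow> real" where
  "add_part f k t = condE k f t - (real CARD('d) - 1) / real CARD('d) * (\<integral>x. f x \<partial>unif)"

lemma sq_int_add_part: "sq_int unif f \<Longrightarrow> sq_int unif (add_part f k)"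
  unfolding add_part_def[abs_def]
  by (intro sq_int_diff sq_int_condE sq_int_const finite_measure_unif)

text \<open>Against \<open>g (x $ j)\<close> the summand for \<open>j\<close> gives
  \<open>\<integral>condE j f * g\<close> minus \<open>(d - 1) / d * m * G\<close>, where
  \<open>m\<close> and \<open>G\<close> are the integrals of \<open>f\<close> and \<open>g\<close>.
  By independence each of the \<open>d - 1\<close> other summands gives \<open>m / d * G\<close>,
  and these cancel the correction.\<close>

lemma integral_add_part_mult:
  fixes f :: "real^'d \<Rightarrow> real"
  assumes f: "sq_int unif f" and g: "sq_int unif g"
  shows "(\<integral>x. (\<Sum>k\<in>UNIV. add_part f k (x $ k)) * g (x $ j) \<partial>unif) = (\<integral>x. f x * g (x $ j) \<partial>unif)"
proof -
  note fin = finite_measure_unif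
  define c where "c = real CARD('d)"
  define m where "m = (\<integral>x. f x \<partial>unif)"
  define G where "G = (\<integral>t. g t \<partial>unif)"
  have "c > 0" by (simp add: c_def)
  have part: "add_part f k = (\<lambda>t. condE k f t - (c - 1) / c * m)" for k
    by (simp add: add_part_def c_def m_def fun_eq_iff)
  note [simp] = sq_int_integrable[OF fin sq_int_condE[OF f]] sq_int_integrable[OF fin g]
    finite_measure.integrable_const[OF fin] measure_unif_space_real
    sq_int_integrable_mult[OF sq_int_condE[OF f] g]
  have int_part: "(\<integral>t. add_part f k t \<partial>unif) = m / c" for k
  proof -
    have "(\<integral>t. add_part f k t \<partial>unif) = m - (c - 1) / c * m"
      unfolding part by (simp add: integral_condE[OF f] m_def[symmetric])
    also have "\<dots> = m / c" using \<open>c > 0\<close> by (simp add: field_simps)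
    finally show ?thesis .
  qed
  have "(\<integral>x. (\<Sum>k\<in>UNIV. add_part f k (x $ k)) * g (x $ j) \<partial>unif)
      = (\<Sum>k\<in>UNIV. \<integral>x. add_part f k (x $ k) * g (x $ j) \<partial>unif)"
    unfolding sum_distrib_right
    by (intro Bochner_Integration.integral_sum sq_int_integrable_mult sq_int_unif_vec_nth sq_int_add_part f g)
  also have "\<dots> = (\<integral>x. add_part f j (x $ j) * g (x $ j) \<partial>(unif :: (real^'d) measure)) + (\<Sum>k\<in>UNIV-{j}. m / c * G)"
    by (simp add: sum.remove[of UNIV j] integral_mult_vec_nth_indep[OF sq_int_add_part[OF f] g] int_part G_def)
  also have "(\<integral>x. add_part f j (x $ j) * g (x $ j) \<partial>(unif :: (real^'d) measure)) = (\<integral>t. add_part f j t * g t \<partial>unif)"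
  proof (rule integral_unif_vec_nth)
    show "(\<lambda>t. add_part f j t * g t) \<in> borel_measurable borel"
      using sq_int_integrable_mult[OF sq_int_add_part[OF f, of j] g] by auto
  qed
  also have "\<dots> = (\<integral>t. condE j f t * g t - (c - 1) / c * m * g t \<partial>unif)"
    by (simp add: part algebra_simps)
  also have "\<dots> = (\<integral>t. condE j f t * g t \<partial>unif) - (c - 1) / c * m * G"
    by (simp add: G_def)
  also have "(\<Sum>k\<in>UNIV-{j}. m / c * G) = (c - 1) / c * m * G"
    by (simp add: c_def card_Diff_singleton of_nat_diff Suc_leI)
  finally show ?thesis by (simp add: integral_mult_vec_nth[OF f g])
qed

text \<open>Linearity reduces this to functions of one coordinate; \<open>sq_int_summand\<close> is
  what allows the integral to be split.\<close>

lemma add_part_orthogonal: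
  fixes f :: "real^'d \<Rightarrow> real"
  assumes f: "sq_int unif f"
    and s: "sq_int (unif :: (real^'d) measure) (\<lambda>x. \<Sum>k\<in>UNIV. g k (x $ k))"
    and g: "\<And>k. g k \<in> borel_measurable borel"
  shows "(\<integral>x. (f x - (\<Sum>k\<in>UNIV. add_part f k (x $ k))) * (\<Sum>k\<in>UNIV. g k (x $ k)) \<partial>unif) = 0"
proof -
  have G: "sq_int unif (g k)" for k by (rule sq_int_summand[OF s g])
  have p: "sq_int unif (\<lambda>x::real^'d. \<Sum>k\<in>UNIV. add_part f k (x $ k))"
    by (intro sq_int_sum sq_int_unif_vec_nth sq_int_add_part f)
  note [simp] = sq_int_integrable_mult[OF f sq_int_unif_vec_nth[OF G]]
    sq_int_integrable_mult[OF p sq_int_unif_vec_nth[OF G]]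
  have "(\<integral>x. (f x - (\<Sum>k\<in>UNIV. add_part f k (x $ k))) * (\<Sum>k\<in>UNIV. g k (x $ k)) \<partial>unif)
      = (\<Sum>j\<in>UNIV. \<integral>x. (f x - (\<Sum>k\<in>UNIV. add_part f k (x $ k))) * g j (x $ j) \<partial>unif)"
    unfolding sum_distrib_left
    by (intro Bochner_Integration.integral_sum sq_int_integrable_mult sq_int_diff f p sq_int_unif_vec_nth G)
  also have "\<dots> = 0"
    by (simp add: left_diff_distrib integral_add_part_mult[OF f G])
  finally show ?thesis .
qed

text \<open>The counterpart for the components \<open>Some k\<close>, which depend on one coordinate
  only: there the projection is the conditional expectation.\<close>

lemma condE_orthogonal:
  fixes f :: "real^'d \<Rightarrow> real"
  assumes f: "sq_int unif f" and g: "sq_int unif g"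
  shows "(\<integral>x. (f x - condE k f (x $ k)) * g (x $ k) \<partial>unif) = 0"
proof -
  have "(\<integral>x. condE k f (x $ k) * g (x $ k) \<partial>(unif :: (real^'d) measure)) = (\<integral>t. condE k f t * g t \<partial>unif)"
    using sq_int_integrable_mult[OF sq_int_condE[OF f, of k] g]
    by (intro integral_unif_vec_nth[of "\<lambda>t. condE k f t * g t"]) auto
  then show ?thesis
    by (simp add: left_diff_distrib integral_mult_vec_nth[OF f g]
        sq_int_integrable_mult[OF f sq_int_unif_vec_nth[OF g]]
        sq_int_integrable_mult[OF sq_int_unif_vec_nth[OF sq_int_condE[OF f]] sq_int_unif_vec_nth[OF g]])
qed

subsection \<open>The projection onto the additive tuples\<close>

lemma borel_measurable_cube: "f \<in> borel_measurable borel \<Longrightarrow> f \<in> borel_measurable cube"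
  by (intro measurable_restrict_space1 measurable_completion) simp

lemma integrable_cube_iff:
  fixes f :: "real^'d \<Rightarrow> real"
  assumes [measurable]: "f \<in> borel_measurable borel"
  shows "integrable cube f \<longleftrightarrow> integrable unif f"
proof -
  have "integrable cube f \<longleftrightarrow> integrable lborel (\<lambda>x. indicator (cbox 0 1) x *\<^sub>R f x)"
    by (simp add: integrable_restrict_space integrable_completion)
  also have "\<dots> \<longleftrightarrow> integrable (density lborel (\<lambda>x. ennreal (indicator (cbox 0 1) x))) f"
    by (subst integrable_density) auto
  finally show ?thesis by (simp add: ennreal_indicator)
qed

lemma integral_cube:
  fixes f :: "real^'d \<Rightarrow> real"
  assumes [measurable]: "f \<in> borel_measurable borel"
  shows "integral\<^sup>L cube f = integral\<^sup>L unif f"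
proof -
  have "integral\<^sup>L cube f = integral\<^sup>L lborel (\<lambda>x. indicator (cbox 0 1) x *\<^sub>R f x)"
    by (simp add: integral_restrict_space integral_completion)
  also have "\<dots> = integral\<^sup>L (density lborel (\<lambda>x. ennreal (indicator (cbox 0 1) x))) f"
    by (subst integral_density) auto
  finally show ?thesis by (simp add: ennreal_indicator)
qed

lemma sq_int_cube_iff:
  fixes f :: "real^'d \<Rightarrow> real"
  assumes "f \<in> borel_measurable borel"
  shows "sq_int cube f \<longleftrightarrow> sq_int unif f"
proof -
  have [measurable]: "f \<in> borel_measurable borel" by fact
  show ?thesis
    by (simp add: sq_int_real_iff borel_measurable_cube integrable_cube_iff)
qed

text \<open>Elements of \<open>F_full\<close> are merely Lebesgue measurable on the cube, while
  resampling needs Borel functions. Extension by 0 gives a Lebesgue measurable function on the whole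
  space, which has a Borel version.\<close>

lemma borel_version_cube:
  fixes f :: "real^'d \<Rightarrow> real"
  assumes "f \<in> borel_measurable cube"
  obtains f' where "f' \<in> borel_measurable borel" "AE x in cube. f x = f' x"
proof -
  have "(\<lambda>x. if x \<in> cbox 0 1 then f x else 0) \<in> borel_measurable lebesgue"
    using assms by (intro borel_measurable_if_I) auto
  then obtain f' where f': "f' \<in> borel_measurable lborel"
    and ae: "AE x in lborel. (if x \<in> cbox 0 1 then f x else 0) = f' x"
    using completion_ex_borel_measurable_real by blast
  from ae have "AE x in lborel. x \<in> cbox 0 1 \<longrightarrow> f x = f' x"
    by eventually_elim auto
  then have "AE x in cube. f x = f' x"
    by (simp add: AE_restrict_space_iff AE_completion_iff)
  with f' show thesis by (intro that[of f']) auto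
qed

lemma sq_int_unif_version:
  fixes f :: "real^'d \<Rightarrow> real"
  assumes "sq_int cube f" "f' \<in> borel_measurable borel" "AE x in cube. f x = f' x"
  shows "sq_int unif f'"
  using sq_int_cong_AE[OF assms(1) borel_measurable_cube[OF assms(2)] assms(3)]
    sq_int_cube_iff[OF assms(2)] by simp

lemma integral_mult_cube_version:
  fixes f g :: "real^'d \<Rightarrow> real"
  assumes [measurable]: "f \<in> borel_measurable cube" "g \<in> borel_measurable cube"
    "f' \<in> borel_measurable borel" "g' \<in> borel_measurable borel"
    and ae: "AE x in cube. f x = f' x" "AE x in cube. g x = g' x"
  shows "(\<integral>x. f x * g x \<partial>cube) = (\<integral>x. f' x * g' x \<partial>unif)"
proof -
  have [measurable]: "f' \<in> borel_measurable cube" "g' \<in> borel_measurable cube"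
    by (simp_all add: borel_measurable_cube)
  have "(\<integral>x. f x * g x \<partial>cube) = (\<integral>x. f' x * g' x \<partial>cube)"
  proof (rule integral_cong_AE)
    show "AE x in cube. f x * g x = f' x * g' x" using ae by eventually_elim simp
  qed measurable
  also have "\<dots> = (\<integral>x. f' x * g' x \<partial>unif)" by (rule integral_cube) measurable
  finally show ?thesis .
qed

lemma F_full_iff: "r \<in> F_full \<longleftrightarrow> sq_int cube r"
  by (simp add: F_full_def sq_int_vec_iff[of cube r] sq_int_real_iff)

lemma F_full_nth: "r \<in> F_full \<Longrightarrow> sq_int cube (\<lambda>x. r x $ l)"
  by (simp add: F_full_iff sq_int_vec_iff[of cube r])

lemma F_add_subset: "r \<in> F_add \<Longrightarrow> r \<in> F_full"
  by (simp add: F_add_def)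

lemma inner2_eq:
  assumes "r \<in> F_full" "s \<in> F_full"
  shows "inner2 r s = (\<integral>x. r x \<bullet> s x \<partial>cube)"
  unfolding inner2_def inner_vec_def inner_real_def
  by (rule Bochner_Integration.integral_sum[symmetric])
    (intro sq_int_integrable_mult F_full_nth assms)

text \<open>The witness is built from Borel versions \<open>f l\<close> of the components: the
  additive part in component \<open>None\<close>, the conditional expectation given coordinate
  \<open>k\<close> in component \<open>Some k\<close>.\<close>

lemma projection_exists:
  fixes r :: "'d::finite tuple_fun"
  assumes r: "r \<in> F_full"
  shows "\<exists>p. p \<in> F_add \<and> (\<forall>q\<in>F_add. inner2 (\<lambda>x. r x - p x) q = 0)"
proof -
  have r_nth: "sq_int cube (\<lambda>x. r x $ l)" for l by (rule F_full_nth[OF r])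
  have "\<exists>f'. f' \<in> borel_measurable borel \<and> (AE x in cube. r x $ l = f' x)" for l
  proof -
    have "(\<lambda>x. r x $ l) \<in> borel_measurable cube" using r_nth by (simp add: sq_int_def)
    from borel_version_cube[OF this] show ?thesis by blast
  qed
  then obtain f where f_meas [measurable]: "\<And>l. f l \<in> borel_measurable borel"
    and f_ae: "\<And>l. AE x in cube. r x $ l = f l x"
    by metis
  have f: "sq_int unif (f l)" for l
    by (rule sq_int_unif_version[OF r_nth f_meas f_ae])
  define p where "p = (\<lambda>x. \<chi> l. case l of None \<Rightarrow> \<Sum>k\<in>UNIV. add_part (f None) k (x $ k)
      | Some k \<Rightarrow> condE k (f (Some k)) (x $ k))"
  have p_None: "p x $ None = (\<Sum>k\<in>UNIV. add_part (f None) k (x $ k))"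
    and p_Some: "p x $ Some k = condE k (f (Some k)) (x $ k)" for x k
    by (simp_all add: p_def)
  have part_meas [measurable]: "add_part (f None) k \<in> borel_measurable borel"
    "condE k (f (Some k)) \<in> borel_measurable borel" for k
    using sq_int_add_part[OF f, of None k] sq_int_condE[OF f, of k "Some k"] by (auto simp: sq_int_def)
  have p_unif: "sq_int unif (\<lambda>x. p x $ l)" for l
    by (cases l) (auto simp: p_None p_Some intro!: sq_int_sum sq_int_unif_vec_nth sq_int_add_part sq_int_condE f)
  then have p_meas [measurable]: "(\<lambda>x. p x $ l) \<in> borel_measurable borel" for l
    by (simp add: sq_int_def)
  have p_nth: "sq_int cube (\<lambda>x. p x $ l)" for l
    using p_unif by (simp add: sq_int_cube_iff)
  have "p \<in> F_full"
    unfolding F_full_iff sq_int_vec_iff[of cube p] using p_nth by blast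
  then have "p \<in> F_add"
    unfolding F_add_def using part_meas p_None p_Some
    by (auto intro!: exI[of _ "add_part (f None)"] exI[of _ "condE k (f (Some k))" for k])
  moreover have "inner2 (\<lambda>x. r x - p x) q = 0" if q: "q \<in> F_add" for q
  proof -
    have q_nth: "sq_int cube (\<lambda>x. q x $ l)" for l
      by (rule F_full_nth[OF F_add_subset[OF q]])
    have diff_meas: "(\<lambda>x. r x $ l - p x $ l) \<in> borel_measurable cube" for l
      using sq_int_diff[OF r_nth p_nth] by (simp add: sq_int_def)
    have diff_ae: "AE x in cube. r x $ l - p x $ l = f l x - p x $ l" for l
      using f_ae[of l] by eventually_elim simp
    have q_meas: "(\<lambda>x. q x $ l) \<in> borel_measurable cube" for l
      using q_nth by (simp add: sq_int_def)
    \<comment> \<open>\<open>inner2\<close> is a sum over components and \<open>F_add\<close>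
      constrains each component separately, so orthogonality is checked one component at a
      time.\<close>
    have "(\<integral>x. (r x $ l - p x $ l) * q x $ l \<partial>cube) = 0" for l
    proof (cases l)
      case None
      from q obtain g where g [measurable]: "\<And>k. g k \<in> borel_measurable borel"
        and ae: "AE x in cube. q x $ None = (\<Sum>k\<in>UNIV. g k (x $ k))"
        by (auto simp: F_add_def)
      have "sq_int (unif :: (real^'d) measure) (\<lambda>x. \<Sum>k\<in>UNIV. g k (x $ k))"
        by (rule sq_int_unif_version[OF q_nth _ ae]) measurable
      from add_part_orthogonal[OF f this g] show ?thesis
        unfolding None by (subst integral_mult_cube_version[OF diff_meas q_meas _ _ diff_ae ae])
          (simp_all add: p_None)
    next
      case (Some k)
      from q obtain g where g [measurable]: "g \<in> borel_measurable borel"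
        and ae: "AE x in cube. q x $ Some k = g (x $ k)"
        by (auto simp: F_add_def)
      have "sq_int (unif :: (real^'d) measure) (\<lambda>x. g (x $ k))"
        by (rule sq_int_unif_version[OF q_nth _ ae]) measurable
      \<comment> \<open>Coordinate \<open>k\<close> is uniformly distributed, so square
        integrability of \<open>g (x $ k)\<close> over the cube passes to \<open>g\<close> on the
        unit interval.\<close>
      then have "integrable (distr unif borel (\<lambda>x::real^'d. x $ k)) (\<lambda>t. (g t)\<^sup>2)"
        by (subst integrable_distr_eq) (simp_all add: sq_int_real_iff)
      then have "sq_int unif g"
        by (simp add: distr_vec_nth sq_int_real_iff)
      from condE_orthogonal[OF f this] show ?thesis
        unfolding Some by (subst integral_mult_cube_version[OF diff_meas q_meas _ _ diff_ae ae])
          (simp_all add: p_Some)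
    qed
    then show ?thesis by (simp add: inner2_def)
  qed
  ultimately show ?thesis by blast
qed

section \<open>Linear structure and inner product up to null sets\<close>

lemma F_full_add: "r \<in> F_full \<Longrightarrow> s \<in> F_full \<Longrightarrow> (\<lambda>x. r x + s x) \<in> F_full"
  by (simp add: F_full_iff sq_int_add)

lemma F_full_diff: "r \<in> F_full \<Longrightarrow> s \<in> F_full \<Longrightarrow> (\<lambda>x. r x - s x) \<in> F_full"
  by (simp add: F_full_iff sq_int_diff)

lemma F_full_scaleR: "r \<in> F_full \<Longrightarrow> (\<lambda>x. c *\<^sub>R r x) \<in> F_full"
  by (simp add: F_full_iff sq_int_scaleR)

lemma ae_eq_refl [simp]: "ae_eq r r"
  by (simp add: ae_eq_def)

lemma ae_eq_sym: "ae_eq r s \<Longrightarrow> ae_eq s r"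
  by (simp add: ae_eq_def eq_commute)

lemma ae_eq_trans: "ae_eq r s \<Longrightarrow> ae_eq s t \<Longrightarrow> ae_eq r t"
  unfolding ae_eq_def by (rule AE_mp, assumption) (rule AE_mp, assumption, simp)

lemma F_full_integrable_inner: "r \<in> F_full \<Longrightarrow> s \<in> F_full \<Longrightarrow> integrable cube (\<lambda>x. r x \<bullet> s x)"
  by (simp add: F_full_iff sq_int_integrable_inner)

lemma inner2_add_left:
  assumes "r \<in> F_full" "s \<in> F_full" "q \<in> F_full"
  shows "inner2 (\<lambda>x. r x + s x) q = inner2 r q + inner2 s q"
  using assms
  by (simp add: inner2_eq F_full_add inner_add_left F_full_integrable_inner)

lemma inner2_scaleR_left: "inner2 (\<lambda>x. c *\<^sub>R r x) q = c * inner2 r q"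
  by (simp add: inner2_def sum_distrib_left mult.assoc)

lemma inner2_commute: "inner2 r q = inner2 q r"
  by (simp add: inner2_def mult.commute)

lemma inner2_add_right:
  "r \<in> F_full \<Longrightarrow> s \<in> F_full \<Longrightarrow> q \<in> F_full \<Longrightarrow> inner2 q (\<lambda>x. r x + s x) = inner2 q r + inner2 q s"
  using inner2_add_left[of r s q] inner2_commute[of q r] inner2_commute[of q s]
    inner2_commute[of q "\<lambda>x. r x + s x"] by simp

lemma inner2_scaleR_right: "inner2 q (\<lambda>x. c *\<^sub>R r x) = c * inner2 q r"
  by (simp add: inner2_commute[of q] inner2_scaleR_left)

lemma inner2_diff_left:
  assumes "r \<in> F_full" "s \<in> F_full" "q \<in> F_full"
  shows "inner2 (\<lambda>x. r x - s x) q = inner2 r q - inner2 s q"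
  using inner2_add_left[OF assms(1) F_full_scaleR[OF assms(2), of "-1"] assms(3)]
  by (simp add: inner2_scaleR_left flip: scaleR_minus_left) (simp add: inner2_def sum_negf)

lemma inner2_cong:
  assumes "r \<in> F_full" "r' \<in> F_full" "q \<in> F_full" "ae_eq r r'"
  shows "inner2 r q = inner2 r' q"
proof -
  have meas: "(\<lambda>x. r x \<bullet> q x) \<in> borel_measurable cube" "(\<lambda>x. r' x \<bullet> q x) \<in> borel_measurable cube"
    using assms by (auto simp: F_full_iff sq_int_def intro!: borel_measurable_inner)
  have "(\<integral>x. r x \<bullet> q x \<partial>cube) = (\<integral>x. r' x \<bullet> q x \<partial>cube)"
    using assms(4) by (intro integral_cong_AE meas) (auto simp: ae_eq_def)
  then show ?thesis using assms by (simp add: inner2_eq)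
qed

lemma norm2_power2: "(norm2 r)\<^sup>2 = inner2 r r"
proof -
  have "0 \<le> (\<Sum>l\<in>UNIV. \<integral>x. (r x $ l)\<^sup>2 \<partial>cube)" by (simp add: sum_nonneg)
  then show ?thesis by (simp add: norm2_def inner2_def power2_eq_square)
qed

lemma norm2_nonneg: "0 \<le> norm2 r"
  by (simp add: norm2_def sum_nonneg)

lemma inner2_self_le_0_imp:
  assumes r: "r \<in> F_full" and "inner2 r r \<le> 0"
  shows "ae_eq r (\<lambda>x. 0)"
proof -
  have int: "integrable cube (\<lambda>x. r x \<bullet> r x)"
    using r by (intro F_full_integrable_inner)
  have "(\<integral>x. r x \<bullet> r x \<partial>cube) = 0"
    using assms by (simp add: inner2_eq antisym)
  then have "AE x in cube. r x \<bullet> r x = 0"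
    using integral_nonneg_eq_0_iff_AE[OF int] by simp
  then show ?thesis by (simp add: ae_eq_def)
qed

section \<open>Linear combinations of additive tuples\<close>

lemma F_add_add:
  assumes "r \<in> F_add" "s \<in> F_add"
  shows "(\<lambda>x. r x + s x) \<in> F_add"
proof -
  from assms obtain g g' where [measurable]: "\<And>k. g k \<in> borel_measurable borel" "\<And>k. g' k \<in> borel_measurable borel"
    and ae: "AE x in cube. r x $ None = (\<Sum>k\<in>UNIV. g k (x $ k))"
      "AE x in cube. s x $ None = (\<Sum>k\<in>UNIV. g' k (x $ k))"
    by (auto simp: F_add_def)
  have "\<exists>g. (\<forall>k. g k \<in> borel_measurable borel)
      \<and> (AE x in cube. (r x + s x) $ None = (\<Sum>k\<in>UNIV. g k (x $ k)))"
  proof (intro exI conjI allI)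
    show "(\<lambda>t. g k t + g' k t) \<in> borel_measurable borel" for k by measurable
    show "AE x in cube. (r x + s x) $ None = (\<Sum>k\<in>UNIV. g k (x $ k) + g' k (x $ k))"
      using ae by eventually_elim (simp add: sum.distrib)
  qed
  moreover have "\<exists>g. g \<in> borel_measurable borel \<and> (AE x in cube. (r x + s x) $ Some k = g (x $ k))" for k
  proof -
    from assms obtain g g' where [measurable]: "g \<in> borel_measurable borel" "g' \<in> borel_measurable borel"
      and ae: "AE x in cube. r x $ Some k = g (x $ k)" "AE x in cube. s x $ Some k = g' (x $ k)"
      by (simp add: F_add_def) blast
    have "AE x in cube. (r x + s x) $ Some k = g (x $ k) + g' (x $ k)"
      using ae by eventually_elim simp
    then show ?thesis by (intro exI[of _ "\<lambda>t. g t + g' t"]) auto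
  qed
  ultimately show ?thesis
    using assms by (auto simp: F_add_def F_full_add simp del: vector_add_component)
qed

lemma F_add_scaleR:
  assumes "r \<in> F_add"
  shows "(\<lambda>x. c *\<^sub>R r x) \<in> F_add"
proof -
  from assms obtain g where [measurable]: "\<And>k. g k \<in> borel_measurable borel"
    and ae: "AE x in cube. r x $ None = (\<Sum>k\<in>UNIV. g k (x $ k))"
    by (auto simp: F_add_def)
  have "\<exists>g. (\<forall>k. g k \<in> borel_measurable borel)
      \<and> (AE x in cube. (c *\<^sub>R r x) $ None = (\<Sum>k\<in>UNIV. g k (x $ k)))"
  proof (intro exI conjI allI)
    show "(\<lambda>t. c * g k t) \<in> borel_measurable borel" for k by measurable
    show "AE x in cube. (c *\<^sub>R r x) $ None = (\<Sum>k\<in>UNIV. c * g k (x $ k))"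
      using ae by eventually_elim (simp add: sum_distrib_left)
  qed
  moreover have "\<exists>g. g \<in> borel_measurable borel \<and> (AE x in cube. (c *\<^sub>R r x) $ Some k = g (x $ k))" for k
  proof -
    from assms obtain g where [measurable]: "g \<in> borel_measurable borel"
      and ae: "AE x in cube. r x $ Some k = g (x $ k)"
      by (simp add: F_add_def) blast
    have "AE x in cube. (c *\<^sub>R r x) $ Some k = c * g (x $ k)"
      using ae by eventually_elim simp
    then show ?thesis by (intro exI[of _ "\<lambda>t. c * g t"]) auto
  qed
  ultimately show ?thesis
    using assms by (auto simp: F_add_def F_full_scaleR simp del: vector_scaleR_component)
qed

lemma F_add_diff:
  assumes "r \<in> F_add" "s \<in> F_add"
  shows "(\<lambda>x. r x - s x) \<in> F_add"
  using F_add_add[OF assms(1) F_add_scaleR[OF assms(2), of "-1"]] by simp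

section \<open>Characterization of \<open>P_add\<close>\<close>

lemma
  assumes "r \<in> F_full"
  shows P_add_in: "P_add r \<in> F_add"
    and P_add_orthogonal: "q \<in> F_add \<Longrightarrow> inner2 (\<lambda>x. r x - P_add r x) q = 0"
  using someI_ex[OF projection_exists[OF assms], folded P_add_def] by blast+

lemma P_add_full: "r \<in> F_full \<Longrightarrow> P_add r \<in> F_full"
  by (rule F_add_subset[OF P_add_in])

lemma inner2_P_add: "r \<in> F_full \<Longrightarrow> q \<in> F_add \<Longrightarrow> inner2 (P_add r) q = inner2 r q"
  using P_add_orthogonal[of r q] inner2_diff_left[of r "P_add r" q] P_add_full[of r] F_add_subset[of q]
  by simp

text \<open>The difference \<open>P_add r - p\<close> is additive and orthogonal to all additive
  tuples, hence to itself. \<open>P_add\<close> chooses a representative, so compatibility with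
  \<open>ae_eq\<close>, the identity on \<open>F_add\<close> and linearity are all derived from
  this.\<close>

lemma P_add_unique:
  assumes r: "r \<in> F_full" and p: "p \<in> F_add" and eq: "\<And>q. q \<in> F_add \<Longrightarrow> inner2 p q = inner2 r q"
  shows "ae_eq (P_add r) p"
proof -
  have d: "(\<lambda>x. P_add r x - p x) \<in> F_add" by (intro F_add_diff P_add_in r p)
  then have "inner2 (\<lambda>x. P_add r x - p x) (\<lambda>x. P_add r x - p x) = 0"
    using r p by (simp add: inner2_diff_left P_add_full F_add_subset inner2_P_add eq)
  then have "ae_eq (\<lambda>x. P_add r x - p x) (\<lambda>x. 0)"
    by (intro inner2_self_le_0_imp F_add_subset d) simp
  then show ?thesis by (simp add: ae_eq_def)
qed

lemma P_add_cong:
  assumes "r \<in> F_full" "s \<in> F_full" "ae_eq r s"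
  shows "ae_eq (P_add r) (P_add s)"
  using assms
  by (intro P_add_unique P_add_in) (simp_all add: inner2_P_add F_add_subset inner2_cong[of s r] ae_eq_sym)

lemma P_add_ident: "r \<in> F_add \<Longrightarrow> ae_eq (P_add r) r"
  by (rule P_add_unique) (simp_all add: F_add_subset)

lemma P_add_lincomb:
  assumes "r \<in> F_full" "s \<in> F_full"
  shows "ae_eq (P_add (\<lambda>x. r x + c *\<^sub>R s x)) (\<lambda>x. P_add r x + c *\<^sub>R P_add s x)"
  using assms
  by (intro P_add_unique F_full_add F_full_scaleR F_add_add F_add_scaleR P_add_in)
    (simp_all add: inner2_add_left inner2_scaleR_left F_full_scaleR P_add_full F_add_subset inner2_P_add)

subsection \<open>The smoothing operator and its resolvent\<close>

lemma is_kernel_continuous: "is_kernel K \<Longrightarrow> continuous_on UNIV K"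
  by (auto simp: is_kernel_def intro: lipschitz_on_continuous_on)

lemma Kh_nonneg: "is_kernel K \<Longrightarrow> 0 \<le> Kh K h z x"
  unfolding Kh_def is_kernel_def by (intro prod_nonneg ballI divide_nonneg_nonneg integral_nonneg_AE) auto

lemma continuous_on_Kh:
  assumes "is_kernel K"
  shows "continuous_on S (\<lambda>x. Kh K h z x)"
proof -
  \<comment> \<open>The divisors \<open>h $ k\<close> and the normalizing integrals do not depend on
    \<open>x\<close>. Written as constant inverse factors, they preserve continuity even when a
    divisor is 0.\<close>
  have "continuous_on S (\<lambda>x. K ((z $ k - x $ k) / h $ k))" for k
    unfolding divide_inverse
    by (intro continuous_on_compose2[OF is_kernel_continuous[OF assms]] continuous_intros) auto
  then show ?thesis
    unfolding Kh_def divide_inverse by (intro continuous_intros) 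
qed

lemma continuous_on_u: "continuous_on S (\<lambda>x. u h z l x)"
  unfolding u_def divide_inverse by (cases l) (auto intro!: continuous_intros)

definition u_vec :: "real^'d::finite \<Rightarrow> real^'d \<Rightarrow> real^'d \<Rightarrow> real^('d option)" where
  "u_vec h z x = (\<chi> l. u h z l x)"

text \<open>\<open>S_mat\<close> is a weighted sum of the rank-one matrices of the vectors
  \<open>u_vec h (X i) x\<close>; symmetry and positive semidefiniteness are read off from this
  form.\<close>

lemma S_mat_mult:
  "S_mat K h n X x *v v = (\<Sum>i=1..n. (Kh K h (X i) x / real n * (u_vec h (X i) x \<bullet> v)) *\<^sub>R u_vec h (X i) x)"
proof (unfold vec_eq_iff, rule allI)
  fix l
  have "(S_mat K h n X x *v v) $ l
      = (\<Sum>m\<in>UNIV. \<Sum>i=1..n. 1 / real n * (Kh K h (X i) x * u h (X i) l x * u h (X i) m x) * v $ m)"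
    by (simp add: matrix_vector_mult_def S_mat_def sum_distrib_left sum_distrib_right)
  also have "\<dots> = (\<Sum>i=1..n. \<Sum>m\<in>UNIV. 1 / real n * (Kh K h (X i) x * u h (X i) l x * u h (X i) m x) * v $ m)"
    by (rule sum.swap)
  also have "\<dots> = (\<Sum>i=1..n. Kh K h (X i) x / real n * (u_vec h (X i) x \<bullet> v) * u_vec h (X i) x $ l)"
    by (intro sum.cong refl) (simp add: inner_vec_def u_vec_def sum_distrib_left sum_distrib_right mult_ac)
  finally show "(S_mat K h n X x *v v) $ l
      = (\<Sum>i=1..n. (Kh K h (X i) x / real n * (u_vec h (X i) x \<bullet> v)) *\<^sub>R u_vec h (X i) x) $ l"
    by simp
qed

lemma inner_S_mat:
  "(S_mat K h n X x *v v) \<bullet> w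
    = (\<Sum>i=1..n. Kh K h (X i) x / real n * (u_vec h (X i) x \<bullet> v) * (u_vec h (X i) x \<bullet> w))"
  by (simp add: S_mat_mult inner_sum_left)

lemma S_mat_symmetric: "(S_mat K h n X x *v v) \<bullet> w = (S_mat K h n X x *v w) \<bullet> v"
  unfolding inner_S_mat by (intro sum.cong) auto

lemma S_mat_psd:
  assumes "is_kernel K"
  shows "0 \<le> (S_mat K h n X x *v v) \<bullet> v"
  unfolding inner_S_mat mult.assoc
  by (rule sum_nonneg, rule mult_nonneg_nonneg) (simp_all add: Kh_nonneg[OF assms])

lemma continuous_on_S_mat: "is_kernel K \<Longrightarrow> continuous_on S (\<lambda>x. S_mat K h n X x $ l $ m)"
  by (simp add: S_mat_def divide_inverse) (intro continuous_intros continuous_on_Kh continuous_on_u)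

lemma continuous_on_r_L: "is_kernel K \<Longrightarrow> continuous_on S (\<lambda>x. r_L K h n X Y x $ l)"
  by (simp add: r_L_def divide_inverse) (intro continuous_intros continuous_on_Kh continuous_on_u)

lemma bounded_cube_continuous:
  fixes a :: "real^'d \<Rightarrow> real"
  assumes "continuous_on UNIV a"
  obtains B where "\<And>x. x \<in> cbox 0 1 \<Longrightarrow> \<bar>a x\<bar> \<le> B"
proof -
  have "bounded (a ` cbox 0 1)"
    by (intro compact_imp_bounded compact_continuous_image compact_cbox continuous_on_subset[OF assms]) auto
  then show thesis using that by (auto simp: bounded_iff)
qed

text \<open>A continuous factor is bounded on the compact cube. Applied to the entries of
  \<open>S_mat\<close>, this makes \<open>S_star\<close> map \<open>F_full\<close> into
  itself.\<close>

lemma sq_int_cube_mult_continuous: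
  fixes a f :: "real^'d \<Rightarrow> real"
  assumes a: "continuous_on UNIV a" and f: "sq_int cube f"
  shows "sq_int cube (\<lambda>x. a x * f x)"
proof -
  obtain B where B: "\<And>x. x \<in> cbox 0 1 \<Longrightarrow> \<bar>a x\<bar> \<le> B"
    using bounded_cube_continuous[OF a] by blast
  have "a \<in> borel_measurable cube"
    by (intro borel_measurable_cube borel_measurable_continuous_onI a)
  then have "(\<lambda>x. a x * f x) \<in> borel_measurable cube"
    using f by (intro borel_measurable_times) (simp_all add: sq_int_def)
  moreover have "AE x in cube. norm (a x * f x) \<le> B * norm (f x)"
    by (rule AE_I2) (auto simp: abs_mult intro!: mult_right_mono B)
  ultimately show ?thesis by (rule sq_int_bound[OF f])
qed

lemma finite_measure_cube: "finite_measure cube"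
  by (rule finite_measureI) (simp add: emeasure_restrict_space emeasure_lborel_cbox_eq)

lemma r_L_full: "is_kernel K \<Longrightarrow> r_L K h n X Y \<in> F_full"
  unfolding F_full_iff sq_int_vec_iff[of cube "r_L K h n X Y"]
  using sq_int_cube_mult_continuous[OF continuous_on_r_L sq_int_const[OF finite_measure_cube], of K h n X Y _ 1]
  by simp

lemma S_star_full:
  assumes K: "is_kernel K" and r: "r \<in> F_full"
  shows "S_star K h n X r \<in> F_full"
  unfolding F_full_iff sq_int_vec_iff[of cube "S_star K h n X r"]
  by (auto simp: S_star_def matrix_vector_mult_def
      intro!: sq_int_sum sq_int_cube_mult_continuous continuous_on_S_mat[OF K] F_full_nth r)

lemma S_star_cong: "ae_eq r s \<Longrightarrow> ae_eq (S_star K h n X r) (S_star K h n X s)"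
  unfolding ae_eq_def S_star_def by (rule AE_mp, assumption) simp

lemma inner2_S_star_commute:
  assumes "is_kernel K" "r \<in> F_full" "s \<in> F_full"
  shows "inner2 (S_star K h n X r) s = inner2 (S_star K h n X s) r"
  using assms by (simp add: inner2_eq S_star_full) (simp add: S_star_def S_mat_symmetric)

text \<open>The equation is solved separately at each point, where \<open>S_mat + R I\<close> is
  coercive with constant \<open>R\<close>. Coercivity gives both invertibility and the bound
  \<open>1 / R\<close> that keeps the solution square integrable.\<close>

lemma resolvent_exists:
  fixes s :: "'d::finite tuple_fun"
  assumes K: "is_kernel K" and R: "0 < R" and s: "s \<in> F_full"
  shows "\<exists>r\<in>F_full. \<forall>x. S_star K h n X r x + R *\<^sub>R r x = s x"
proof -
  define A where "A x = S_mat K h n X x + R *\<^sub>R mat 1" for x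
  have A_mult: "A x *v v = S_mat K h n X x *v v + R *\<^sub>R v" for x v
    by (simp add: A_def matrix_vector_mult_add_rdistrib flip: scaleR_matrix_vector_assoc)
  have A_lower: "R * (norm v)\<^sup>2 \<le> (A x *v v) \<bullet> v" for x v
    using S_mat_psd[OF K, of h n X x v] by (simp add: A_mult inner_add_left power2_norm_eq_inner)
  have "v = 0" if "A x *v v = 0" for x v
    using A_lower[of v x] that R by (simp add: mult_le_0_iff)
  then have det: "det (A x) \<noteq> 0" for x
    using matrix_left_invertible_ker[of "A x"] invertible_left_inverse[of "A x"] invertible_det_nz[of "A x"] by blast
  \<comment> \<open>Cramer's rule makes the solution an explicit rational expression in the entries
    of \<open>A x\<close> and \<open>s x\<close>, so its measurability in \<open>x\<close> is
    visible.\<close>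
  define r where "r x = (\<chi> k. det (\<chi> i j. if j = k then s x $ i else A x $ i $ j) / det (A x))" for x
  have Ar: "A x *v r x = s x" for x
    unfolding r_def using cramer[OF det, of x _ "s x"] by simp
  have s_meas [measurable]: "(\<lambda>x. s x $ i) \<in> borel_measurable cube" for i
    using F_full_nth[OF s] by (simp add: sq_int_def)
  have A_cont: "continuous_on UNIV (\<lambda>x. A x $ i $ j)" for i j
    by (simp add: A_def) (intro continuous_intros continuous_on_S_mat K)
  have A_meas [measurable]: "(\<lambda>x. A x $ i $ j) \<in> borel_measurable cube" for i j
    by (intro borel_measurable_cube borel_measurable_continuous_onI A_cont)
  have "(\<lambda>x. r x $ k) \<in> borel_measurable cube" for k
    unfolding r_def det_def by simp
  then have "r \<in> borel_measurable cube"
    by (simp add: borel_measurable_vec_iff)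
  moreover have "norm (r x) \<le> (1 / R) * norm (s x)" for x
  proof -
    have "R * (norm (r x))\<^sup>2 \<le> s x \<bullet> r x"
      using A_lower[of "r x" x] by (simp add: Ar)
    also have "\<dots> \<le> norm (s x) * norm (r x)" by (rule norm_cauchy_schwarz)
    finally have "R * norm (r x) * norm (r x) \<le> norm (s x) * norm (r x)"
      by (simp add: power2_eq_square mult.assoc)
    then have "R * norm (r x) \<le> norm (s x)"
      by (cases "norm (r x) = 0") (auto simp: mult_le_cancel_right)
    then show ?thesis using R by (simp add: field_simps)
  qed
  ultimately have "r \<in> F_full"
    using s unfolding F_full_iff by (auto intro!: sq_int_bound[of cube s r "1 / R"])
  with Ar show ?thesis
    by (intro bexI[of _ r]) (auto simp: S_star_def A_mult)
qed

lemma resolvent_inj: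
  assumes K: "is_kernel K" and R: "0 < R"
    and eq: "S_mat K h n X x *v v + R *\<^sub>R v = S_mat K h n X x *v w + R *\<^sub>R w"
  shows "v = w"
proof -
  have "S_mat K h n X x *v (v - w) + R *\<^sub>R (v - w) = 0"
    using eq by (simp add: matrix_vector_mult_diff_distrib algebra_simps)
  then have "(S_mat K h n X x *v (v - w)) \<bullet> (v - w) + R * ((v - w) \<bullet> (v - w)) = 0"
    by (metis inner_add_left inner_scaleR_left inner_zero_left)
  then have "R * ((v - w) \<bullet> (v - w)) \<le> 0"
    using S_mat_psd[OF K, of h n X x "v - w"] by linarith
  then have "(norm (v - w))\<^sup>2 \<le> 0" using R by (simp add: mult_le_0_iff power2_norm_eq_inner)
  then show ?thesis by simp
qed

text \<open>The right-hand side \<open>s'\<close> may be any function that agrees almost everywhere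
  with a square integrable \<open>s\<close>. This covers \<open>S_star r_ll\<close>, which agrees
  with \<open>r_L\<close> although \<open>r_ll\<close> itself may fail to be square
  integrable.\<close>

lemma
  assumes K: "is_kernel K" and R: "0 < R" and s: "s \<in> F_full" and ae: "ae_eq s s'"
  shows S_res_full: "S_res K h n X R s' \<in> F_full"
    and S_res_eq: "ae_eq (\<lambda>x. S_star K h n X (S_res K h n X R s') x + R *\<^sub>R S_res K h n X R s' x) s"
proof -
  obtain r where r: "r \<in> F_full" "\<forall>x. S_star K h n X r x + R *\<^sub>R r x = s x"
    using resolvent_exists[OF K R s] by blast
  then have "ae_eq (\<lambda>x. S_star K h n X r x + R *\<^sub>R r x) s'" using ae by simp
  with r(1) have "\<exists>r. r \<in> F_full \<and> ae_eq (\<lambda>x. S_star K h n X r x + R *\<^sub>R r x) s'" by blast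
  from someI_ex[OF this] show "S_res K h n X R s' \<in> F_full"
    "ae_eq (\<lambda>x. S_star K h n X (S_res K h n X R s') x + R *\<^sub>R S_res K h n X R s' x) s"
    unfolding S_res_def op_inv_def using ae_eq_trans ae_eq_sym[OF ae] by blast+
qed

text \<open>Pointwise injectivity identifies a solution found by other means with the one chosen by
  \<open>op_inv\<close>.\<close>

lemma S_res_unique:
  assumes K: "is_kernel K" and R: "0 < R" and s: "s \<in> F_full" and ae: "ae_eq s s'"
    and r: "ae_eq (\<lambda>x. S_star K h n X r x + R *\<^sub>R r x) s"
  shows "ae_eq r (S_res K h n X R s')"
proof -
  have "ae_eq (\<lambda>x. S_star K h n X r x + R *\<^sub>R r x)
      (\<lambda>x. S_star K h n X (S_res K h n X R s') x + R *\<^sub>R S_res K h n X R s' x)"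
    by (rule ae_eq_trans[OF r ae_eq_sym[OF S_res_eq[OF K R s ae]]])
  then show ?thesis
    unfolding ae_eq_def S_star_def by eventually_elim (rule resolvent_inj[OF K R])
qed

subsection \<open>The penalized minimizer\<close>

text \<open>Expanding the square at each point: \<open>r_L\<close> is the coefficient of the linear
  term and \<open>S_mat\<close> the matrix of the quadratic form.\<close>

lemma integrand_Q:
  "1 / real n * (\<Sum>i=1..n. (Y i - v $ None - (\<Sum>k\<in>UNIV. v $ Some k * ((X i $ k - x $ k) / h $ k)))\<^sup>2 * Kh K h (X i) x)
    = 1 / real n * (\<Sum>i=1..n. (Y i)\<^sup>2 * Kh K h (X i) x) - 2 * (r_L K h n X Y x \<bullet> v) + (S_mat K h n X x *v v) \<bullet> v"
proof -
  \<comment> \<open>The local linear fit at a data point \<open>z\<close> is the inner product of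
    \<open>v\<close> with \<open>u_vec h z x\<close>.\<close>
  have dot: "v $ None + (\<Sum>k\<in>UNIV. v $ Some k * ((z $ k - x $ k) / h $ k)) = u_vec h z x \<bullet> v" for z
    by (simp add: inner_vec_def u_vec_def u_def UNIV_option_conv sum.reindex mult.commute)
  have r_L: "r_L K h n X Y x = (\<Sum>i=1..n. (1 / real n * (Kh K h (X i) x * Y i)) *\<^sub>R u_vec h (X i) x)"
    by (simp add: vec_eq_iff r_L_def u_vec_def sum_distrib_left mult_ac)
  have "1 / real n * (\<Sum>i=1..n. (Y i - v $ None - (\<Sum>k\<in>UNIV. v $ Some k * ((X i $ k - x $ k) / h $ k)))\<^sup>2 * Kh K h (X i) x)
     = (\<Sum>i=1..n. 1 / real n * ((Y i - u_vec h (X i) x \<bullet> v)\<^sup>2 * Kh K h (X i) x))"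
    unfolding dot[symmetric] diff_diff_add sum_distrib_left ..
  also have "\<dots> = (\<Sum>i=1..n. 1 / real n * ((Y i)\<^sup>2 * Kh K h (X i) x)
      - 2 * (1 / real n * (Kh K h (X i) x * Y i) * (u_vec h (X i) x \<bullet> v))
      + Kh K h (X i) x / real n * (u_vec h (X i) x \<bullet> v) * (u_vec h (X i) x \<bullet> v))"
    by (intro sum.cong refl) (simp add: power2_diff power2_eq_square field_simps)
  also have "\<dots> = 1 / real n * (\<Sum>i=1..n. (Y i)\<^sup>2 * Kh K h (X i) x) - 2 * (r_L K h n X Y x \<bullet> v)
      + (S_mat K h n X x *v v) \<bullet> v"
    unfolding inner_S_mat r_L inner_sum_left inner_scaleR_left
    by (simp only: sum.distrib sum_subtractf sum_distrib_left)
  finally show ?thesis .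
qed

lemma Q_eq:
  assumes K: "is_kernel K" and r: "r \<in> F_full"
  shows "Q K h n X Y r = (\<integral>x. 1 / real n * (\<Sum>i=1..n. (Y i)\<^sup>2 * Kh K h (X i) x) \<partial>cube)
    - 2 * inner2 (r_L K h n X Y) r + inner2 (S_star K h n X r) r"
proof -
  have "continuous_on UNIV (\<lambda>x. 1 / real n * (\<Sum>i=1..n. (Y i)\<^sup>2 * Kh K h (X i) x))"
    unfolding divide_inverse by (intro continuous_intros continuous_on_Kh K)
  then have 1: "integrable cube (\<lambda>x. 1 / real n * (\<Sum>i=1..n. (Y i)\<^sup>2 * Kh K h (X i) x))"
    using continuous_imp_integrable continuous_on_subset by blast
  have 2: "integrable cube (\<lambda>x. r_L K h n X Y x \<bullet> r x)"
    by (intro F_full_integrable_inner r r_L_full[OF K])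
  have 3: "integrable cube (\<lambda>x. (S_mat K h n X x *v r x) \<bullet> r x)"
    using F_full_integrable_inner[OF S_star_full[OF K r] r] by (simp add: S_star_def)
  have "inner2 (S_star K h n X r) r = (\<integral>x. (S_mat K h n X x *v r x) \<bullet> r x \<partial>cube)"
    by (simp add: inner2_eq r S_star_full[OF K r]) (simp add: S_star_def)
  then show ?thesis
    using 1 2 3 unfolding Q_def integrand_Q by (simp add: inner2_eq r r_L_full[OF K])
qed

lemma quadratic_nonneg_imp_linear_eq_0:
  fixes a b :: real
  assumes "\<And>t. 0 \<le> 2 * t * a + t\<^sup>2 * b"
  shows "a = 0"
proof (rule ccontr)
  assume "a \<noteq> 0"
  \<comment> \<open>\<open>c\<close> is positive and at least \<open>b\<close> whatever the sign of
    \<open>b\<close>. At \<open>t = - a / c\<close> the expression is then at most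
    \<open>- a^2 / c\<close>, which is negative.\<close>
  define c where "c = \<bar>b\<bar> + 1"
  have c: "c > 0" "b \<le> c" by (simp_all add: c_def)
  have "0 \<le> 2 * (- a / c) * a + (- a / c)\<^sup>2 * b" by (rule assms)
  also have "\<dots> \<le> 2 * (- a / c) * a + (- a / c)\<^sup>2 * c"
    using c by (intro add_left_mono mult_left_mono) auto
  also have "\<dots> = - (a\<^sup>2 / c)" using c by (simp add: power2_eq_square field_simps)
  also have "\<dots> < 0" using c \<open>a \<noteq> 0\<close> by simp
  finally show False by simp
qed

lemma F_full_residual: "r \<in> F_full \<Longrightarrow> (\<lambda>x. r x - P_add r x) \<in> F_full"
  by (intro F_full_diff P_add_full)

lemma inner2_S_star_lincomb:
  assumes K: "is_kernel K" and r: "r \<in> F_full" and q: "q \<in> F_full"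
  shows "inner2 (S_star K h n X (\<lambda>x. r x + t *\<^sub>R q x)) (\<lambda>x. r x + t *\<^sub>R q x)
    = inner2 (S_star K h n X r) r + 2 * t * inner2 (S_star K h n X r) q + t\<^sup>2 * inner2 (S_star K h n X q) q"
proof -
  have S: "S_star K h n X (\<lambda>x. r x + t *\<^sub>R q x) = (\<lambda>x. S_star K h n X r x + t *\<^sub>R S_star K h n X q x)"
    by (simp add: S_star_def matrix_vector_right_distrib matrix_vector_mult_scaleR)
  note full = r q S_star_full[OF K r] S_star_full[OF K q]
  have *: "inner2 (S_star K h n X s) (\<lambda>x. r x + t *\<^sub>R q x)
      = inner2 (S_star K h n X s) r + t * inner2 (S_star K h n X s) q" if "s \<in> F_full" for s
    using inner2_add_right[OF r F_full_scaleR[OF q] S_star_full[OF K that]]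
    by (simp add: inner2_scaleR_right)
  show ?thesis
    unfolding S
    by (simp add: inner2_add_left inner2_scaleR_left full F_full_add F_full_scaleR *
        inner2_S_star_commute[OF K q r] power2_eq_square algebra_simps)
qed

text \<open>Taking residuals is linear up to null sets, so the square expands by bilinearity with
  cross term the inner product of the two residuals.\<close>

lemma norm2_residual_lincomb:
  assumes r: "r \<in> F_full" and q: "q \<in> F_full"
  shows "(norm2 (\<lambda>x. (r x + t *\<^sub>R q x) - P_add (\<lambda>x. r x + t *\<^sub>R q x) x))\<^sup>2
    = (norm2 (\<lambda>x. r x - P_add r x))\<^sup>2 + 2 * t * inner2 (\<lambda>x. r x - P_add r x) q
      + t\<^sup>2 * (norm2 (\<lambda>x. q x - P_add q x))\<^sup>2"
proof -
  define a where "a = (\<lambda>x. r x - P_add r x)"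
  define b where "b = (\<lambda>x. q x - P_add q x)"
  define c where "c = (\<lambda>x. (r x + t *\<^sub>R q x) - P_add (\<lambda>x. r x + t *\<^sub>R q x) x)"
  have full: "a \<in> F_full" "b \<in> F_full" "c \<in> F_full"
    using r q by (auto simp: a_def b_def c_def intro!: F_full_diff P_add_full F_full_add F_full_scaleR)
  have ab: "(\<lambda>x. a x + t *\<^sub>R b x) \<in> F_full" by (intro F_full_add F_full_scaleR full)
  have ae: "ae_eq c (\<lambda>x. a x + t *\<^sub>R b x)"
    using P_add_lincomb[OF r q, of t] unfolding ae_eq_def
    by eventually_elim (simp add: a_def b_def c_def algebra_simps)
  have "inner2 c c = inner2 (\<lambda>x. a x + t *\<^sub>R b x) c"
    by (rule inner2_cong[OF full(3) ab full(3) ae])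
  also have "\<dots> = inner2 (\<lambda>x. a x + t *\<^sub>R b x) (\<lambda>x. a x + t *\<^sub>R b x)"
    using inner2_cong[OF full(3) ab ab ae] by (simp add: inner2_commute)
  also have "\<dots> = inner2 a a + 2 * t * inner2 a b + t\<^sup>2 * inner2 b b"
  proof -
    have *: "inner2 s (\<lambda>x. a x + t *\<^sub>R b x) = inner2 s a + t * inner2 s b" if "s \<in> F_full" for s
      using inner2_add_right[OF full(1) F_full_scaleR[OF full(2)] that]
      by (simp add: inner2_scaleR_right)
    show ?thesis
      by (simp add: inner2_add_left inner2_scaleR_left full ab F_full_scaleR * inner2_commute[of b a]
          power2_eq_square algebra_simps)
  qed
  \<comment> \<open>The residual \<open>a\<close> is orthogonal to the additive tuple
    \<open>P_add q\<close>, so \<open>b = q - P_add q\<close> may be replaced by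
    \<open>q\<close>.\<close>
  also have "inner2 a b = inner2 a q"
    using inner2_diff_left[OF q P_add_full[OF q] full(1)] P_add_orthogonal[OF r P_add_in[OF q]]
    by (simp add: b_def a_def inner2_commute)
  finally show ?thesis by (simp add: norm2_power2 a_def b_def c_def)
qed

text \<open>Let \<open>e\<close> be the difference of the two sides. Along \<open>r + t q\<close>
  the criterion changes by \<open>2 t * inner2 e q\<close> plus a multiple of \<open>t^2\<close>;
  minimality for all \<open>t\<close> makes the linear coefficient vanish, and the direction
  \<open>q = e\<close> yields \<open>e = 0\<close> almost everywhere.\<close>

lemma minimizer_normal_equation:
  assumes K: "is_kernel K" and min: "is_arg_min (Q_pen K h n X Y R) (\<lambda>r. r \<in> F_full) r"
  shows "ae_eq (\<lambda>x. S_star K h n X r x + R *\<^sub>R (r x - P_add r x)) (r_L K h n X Y)"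
proof -
  have r: "r \<in> F_full" using min by (simp add: is_arg_min_def)
  define a where "a = (\<lambda>x. r x - P_add r x)"
  define e where "e = (\<lambda>x. (S_star K h n X r x + R *\<^sub>R a x) - r_L K h n X Y x)"
  have a: "a \<in> F_full" unfolding a_def by (rule F_full_residual[OF r])
  note full = r a S_star_full[OF K r] r_L_full[OF K] F_full_scaleR F_full_add
  have e: "e \<in> F_full" unfolding e_def by (intro F_full_diff full)
  have "0 \<le> 2 * t * inner2 e q + t\<^sup>2 * (inner2 (S_star K h n X q) q + R * (norm2 (\<lambda>x. q x - P_add q x))\<^sup>2)"
    if q: "q \<in> F_full" for q t
  proof -
    have rq: "(\<lambda>x. r x + t *\<^sub>R q x) \<in> F_full" by (intro full q)
    have "Q_pen K h n X Y R r \<le> Q_pen K h n X Y R (\<lambda>x. r x + t *\<^sub>R q x)"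
      using min rq by (auto simp: is_arg_min_def not_less)
    moreover have L: "inner2 (r_L K h n X Y) (\<lambda>x. r x + t *\<^sub>R q x)
        = inner2 (r_L K h n X Y) r + t * inner2 (r_L K h n X Y) q"
      using inner2_add_right[OF r F_full_scaleR[OF q] r_L_full[OF K]]
      by (simp add: inner2_scaleR_right)
    moreover have E: "inner2 e q = inner2 (S_star K h n X r) q + R * inner2 a q - inner2 (r_L K h n X Y) q"
      unfolding e_def by (simp add: inner2_diff_left inner2_add_left inner2_scaleR_left full q)
    ultimately show ?thesis
      unfolding Q_pen_def Q_eq[OF K r] Q_eq[OF K rq] inner2_S_star_lincomb[OF K r q]
        norm2_residual_lincomb[OF r q] L E a_def
      by (simp add: algebra_simps)
  qed
  then have "inner2 e e = 0"
    using quadratic_nonneg_imp_linear_eq_0 e by blast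
  then have "ae_eq e (\<lambda>x. 0)" by (intro inner2_self_le_0_imp e) simp
  then show ?thesis by (simp add: ae_eq_def e_def a_def)
qed

section \<open>Injectivity of \<open>S_star\<close> on additive tuples and of
  \<open>Lambda_star\<close>\<close>

lemma inner2_self_mono:
  assumes "z \<in> F_full" "d \<in> F_full" "AE x in cube. z x \<bullet> z x \<le> z x \<bullet> d x"
  shows "inner2 z z \<le> inner2 z d"
  using assms by (simp add: inner2_eq F_full_iff sq_int_integrable_inner integral_mono_AE)

lemma ae_eq_norm2_0:
  assumes "ae_eq r s"
  shows "norm2 (\<lambda>x. r x - s x) = 0"
proof -
  have "(\<integral>x. ((r x - s x) $ l)\<^sup>2 \<partial>cube) = 0" for l
  proof (rule integral_eq_zero_AE)
    show "AE x in cube. ((r x - s x) $ l)\<^sup>2 = 0"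
      using assms unfolding ae_eq_def by eventually_elim simp
  qed
  then show ?thesis by (simp add: norm2_def)
qed

text \<open>\<open>T'\<close> acts on functions, so its inverse identities alone do not make it
  respect \<open>ae_eq\<close>. Continuity does: functions equal almost everywhere are at distance
  0, hence so are their images. Comparing \<open>T'\<close> at \<open>S_add d\<close> and at
  \<open>S_add Z\<close> with \<open>Z\<close> the zero tuple then gives
  \<open>d = Z\<close>.\<close>

lemma S_add_kernel:
  fixes d :: "'d::finite tuple_fun"
  assumes K: "is_kernel K" and inv: "has_continuous_inverse F_add (S_add K h n X)"
    and d: "d \<in> F_add" and S0: "ae_eq (S_star K h n X d) (\<lambda>x. 0)"
  shows "ae_eq d (\<lambda>x. 0)"
proof -
  define Z :: "'d tuple_fun" where "Z = (\<lambda>x. 0)"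
  have Z: "Z \<in> F_add"
    using F_add_scaleR[OF d, of 0] by (simp add: Z_def)
  from inv obtain T' where T': "\<And>r. r \<in> F_add \<Longrightarrow> T' r \<in> F_add"
      "\<And>r. r \<in> F_add \<Longrightarrow> ae_eq (T' (S_add K h n X r)) r"
    and cont: "\<And>r e. r \<in> F_add \<Longrightarrow> e > 0 \<Longrightarrow> \<exists>\<delta>>0. \<forall>s\<in>F_add.
        norm2 (\<lambda>x. s x - r x) < \<delta> \<longrightarrow> norm2 (\<lambda>x. T' s x - T' r x) < e"
    unfolding has_continuous_inverse_def by blast
  have S_add_in: "S_add K h n X r \<in> F_add" if "r \<in> F_add" for r
    unfolding S_add_def by (intro P_add_in S_star_full K P_add_full[OF F_add_subset[OF that]])
  have S_add_0: "ae_eq (S_add K h n X r) Z" if r: "r \<in> F_add" and "ae_eq (S_star K h n X r) Z" for r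
  proof -
    have "ae_eq (S_star K h n X (P_add r)) Z"
      using ae_eq_trans[OF S_star_cong[OF P_add_ident[OF r]] that(2)] .
    then have "ae_eq (S_add K h n X r) (P_add Z)"
      unfolding S_add_def
      by (intro P_add_cong S_star_full K P_add_full F_add_subset[OF r] F_add_subset[OF Z])
    then show ?thesis using P_add_ident[OF Z] by (rule ae_eq_trans)
  qed
  have SZ: "ae_eq (S_star K h n X Z) Z" by (simp add: S_star_def Z_def)
  have ae: "ae_eq (S_add K h n X d) (S_add K h n X Z)"
    using ae_eq_trans[OF S_add_0[OF d S0[folded Z_def]] ae_eq_sym[OF S_add_0[OF Z SZ]]] .
  let ?w = "\<lambda>x. T' (S_add K h n X d) x - T' (S_add K h n X Z) x"
  have w: "?w \<in> F_full"
    by (intro F_full_diff F_add_subset[OF T'(1)] S_add_in d Z)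
  have "norm2 ?w < e" if "e > 0" for e
    using cont[OF S_add_in[OF Z] that] S_add_in[OF d] ae_eq_norm2_0[OF ae] by auto
  then have "norm2 ?w \<le> 0" by (meson less_irrefl not_le)
  then have "norm2 ?w = 0" using norm2_nonneg by (intro antisym)
  then have "inner2 ?w ?w \<le> 0" by (simp flip: norm2_power2)
  then have "ae_eq ?w (\<lambda>x. 0)" by (rule inner2_self_le_0_imp[OF w])
  then have "ae_eq (T' (S_add K h n X d)) (T' (S_add K h n X Z))" by (simp add: ae_eq_def)
  then have "ae_eq d Z"
    using ae_eq_trans[OF ae_eq_sym[OF T'(2)[OF d]] ae_eq_trans[OF _ T'(2)[OF Z]]] by blast
  then show ?thesis by (simp add: Z_def)
qed

text \<open>\<open>P_star\<close> is defined through an arbitrarily chosen preimage under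
  \<open>Lambda_star\<close>; injectivity is what identifies that preimage with the additive part of
  the minimizer.\<close>

lemma Lambda_star_inj:
  assumes K: "is_kernel K" and R: "0 < R" and inv: "has_continuous_inverse F_add (S_add K h n X)"
    and v: "v \<in> F_add" and w: "w \<in> F_add"
    and eq: "ae_eq (Lambda_star K h n X R v) (Lambda_star K h n X R w)"
  shows "ae_eq v w"
proof -
  define y where "y r = S_res K h n X R (S_star K h n X (P_add r))" for r
  have y: "y r \<in> F_full"
    and y_eq: "ae_eq (\<lambda>x. S_star K h n X (y r) x + R *\<^sub>R y r x) (S_star K h n X (P_add r))"
    if "r \<in> F_add" for r
    unfolding y_def
    using S_res_full[OF K R S_star_full[OF K P_add_full[OF F_add_subset[OF that]]] ae_eq_refl]
      S_res_eq[OF K R S_star_full[OF K P_add_full[OF F_add_subset[OF that]]] ae_eq_refl] .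
  define z where "z = (\<lambda>x. y v x - y w x)"
  define d where "d = (\<lambda>x. v x - w x)"
  have d: "d \<in> F_add" unfolding d_def by (rule F_add_diff[OF v w])
  have z: "z \<in> F_full" unfolding z_def by (intro F_full_diff y v w)
  have resolvent: "AE x in cube. S_mat K h n X x *v z x + R *\<^sub>R z x = S_mat K h n X x *v d x"
    using y_eq[OF v] y_eq[OF w] P_add_ident[OF v] P_add_ident[OF w]
    unfolding ae_eq_def S_star_def
    by eventually_elim (simp add: z_def d_def matrix_vector_mult_diff_distrib algebra_simps)
  have "AE x in cube. z x \<bullet> z x \<le> z x \<bullet> d x"
    using resolvent
  proof eventually_elim
    case (elim x)
    \<comment> \<open>For \<open>e = d - z\<close> the resolvent equation reads
      \<open>S e = R z\<close>, so semidefiniteness at \<open>e\<close> bounds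
      \<open>R (z \<bullet> e)\<close> from below by 0.\<close>
    define e where "e = d x - z x"
    have Se: "S_mat K h n X x *v e = R *\<^sub>R z x"
      using elim by (simp add: e_def matrix_vector_mult_diff_distrib algebra_simps)
    have "0 \<le> R * (z x \<bullet> e)"
      using S_mat_psd[OF K, of h n X x e] by (simp add: Se)
    then have "0 \<le> z x \<bullet> e" using R by (simp add: zero_le_mult_iff)
    then show ?case by (simp add: e_def inner_diff_right)
  qed
  then have "inner2 z z \<le> inner2 z d"
    by (intro inner2_self_mono z F_add_subset[OF d])
  also have "inner2 z d = inner2 (y v) d - inner2 (y w) d"
    unfolding z_def by (intro inner2_diff_left y v w F_add_subset[OF d])
  \<comment> \<open>\<open>d\<close> is additive and therefore sees \<open>y v\<close> and
    \<open>y w\<close> only through their projections, which are the two values of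
    \<open>Lambda_star\<close> assumed equal.\<close>
  also have "\<dots> = inner2 (P_add (y v)) d - inner2 (P_add (y w)) d"
    using y v w d by (simp add: inner2_P_add)
  also have "\<dots> = 0"
    using inner2_cong[OF P_add_full[OF y[OF v]] P_add_full[OF y[OF w]] F_add_subset[OF d]]
      eq[unfolded Lambda_star_def, folded y_def] by simp
  finally have "ae_eq z (\<lambda>x. 0)" by (rule inner2_self_le_0_imp[OF z])
  then have "ae_eq (S_star K h n X d) (\<lambda>x. 0)"
    using resolvent unfolding ae_eq_def S_star_def by eventually_elim simp
  then have "ae_eq d (\<lambda>x. 0)" by (rule S_add_kernel[OF K inv d])
  then show ?thesis by (simp add: ae_eq_def d_def)
qed

section \<open>The two components of the penalized minimizer\<close>

theorem proposition3:
  fixes K :: "real \<Rightarrow> real" and h :: "real^'d::finite" and n :: nat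
    and X :: "nat \<Rightarrow> real^'d" and Y :: "nat \<Rightarrow> real" and R :: real
    and r_R r_ll :: "'d tuple_fun"
  assumes "1 \<le> n"
    and "\<And>i. i \<in> {1..n} \<Longrightarrow> X i \<in> cbox 0 1"
    and "\<And>k. 0 < h $ k"
    and "is_kernel K"
    and "0 < R"
    and "has_continuous_inverse F_add (S_add K h n X)"
    and "is_arg_min (Q_pen K h n X Y R) (\<lambda>r. r \<in> F_full) r_R"
    and "is_local_linear K h n X Y r_ll"
  shows "ae_eq (P_add r_R) (P_star K h n X R r_ll) \<and>
         ae_eq (\<lambda>x. r_R x - P_add r_R x)
               (S_res K h n X R (S_star K h n X (\<lambda>x. r_ll x - P_star K h n X R r_ll x)))"
proof -
  note K = \<open>is_kernel K\<close> and R = \<open>0 < R\<close>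
  let ?S = "S_star K h n X" and ?res = "S_res K h n X R" and ?L = "r_L K h n X Y"
  have r: "r_R \<in> F_full" using assms(7) by (simp add: is_arg_min_def)
  have normal: "ae_eq (\<lambda>x. ?S r_R x + R *\<^sub>R (r_R x - P_add r_R x)) ?L"
    by (rule minimizer_normal_equation[OF K assms(7)])
  have ll: "ae_eq ?L (?S r_ll)"
    using assms(8) unfolding is_local_linear_def by (rule ae_eq_sym)
  define p where "p = P_add r_R"
  define a where "a = (\<lambda>x. r_R x - p x)"
  have p: "p \<in> F_add" unfolding p_def by (rule P_add_in[OF r])
  have a: "a \<in> F_full" unfolding a_def p_def by (rule F_full_residual[OF r])
  have Pp: "ae_eq (P_add p) p" by (rule P_add_ident[OF p])
  \<comment> \<open>\<open>y\<close> is \<open>(S + R)^{-1} S p\<close>, with \<open>P_add p\<close>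
    in place of \<open>p\<close> so that \<open>P_add y\<close> is literally
    \<open>Lambda_star\<close> at \<open>p\<close>.\<close>
  define y where "y = ?res (?S (P_add p))"
  have SPp: "?S (P_add p) \<in> F_full" by (intro S_star_full K P_add_full F_add_subset[OF p])
  have y: "y \<in> F_full" unfolding y_def by (rule S_res_full[OF K R SPp ae_eq_refl])
  have y_eq: "ae_eq (\<lambda>x. ?S y x + R *\<^sub>R y x) (?S (P_add p))"
    unfolding y_def by (rule S_res_eq[OF K R SPp ae_eq_refl])
  have ay: "(\<lambda>x. y x + 1 *\<^sub>R a x) \<in> F_full" by (intro F_full_add F_full_scaleR a y)
  \<comment> \<open>The equation of \<open>y\<close> contributes \<open>S p\<close>, and the normal
    equation says \<open>S p + S a + R a = r_L\<close>. So \<open>y + a\<close> is the resolvent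
    applied to \<open>r_L\<close>; the factor 1 matches the form of
    \<open>P_add_lincomb\<close>.\<close>
  have "ae_eq (\<lambda>x. ?S (\<lambda>x. y x + 1 *\<^sub>R a x) x + R *\<^sub>R (y x + 1 *\<^sub>R a x)) ?L"
    using y_eq normal Pp unfolding ae_eq_def S_star_def
    by eventually_elim
      (simp add: a_def p_def[symmetric] matrix_vector_right_distrib matrix_vector_mult_diff_distrib algebra_simps)
  then have "ae_eq (\<lambda>x. y x + 1 *\<^sub>R a x) (?res (?S r_ll))"
    by (rule S_res_unique[OF K R r_L_full[OF K] ll])
  then have "ae_eq (P_add (?res (?S r_ll))) (P_add (\<lambda>x. y x + 1 *\<^sub>R a x))"
    using P_add_cong[OF S_res_full[OF K R r_L_full[OF K] ll] ay] ae_eq_sym by blast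
  moreover have "ae_eq (P_add a) (\<lambda>x. 0)"
  proof (rule P_add_unique[OF a])
    show "((\<lambda>x. 0) :: 'd tuple_fun) \<in> F_add" using F_add_scaleR[OF p, of 0] by simp
    show "inner2 (\<lambda>x. 0) q = inner2 a q" if "q \<in> F_add" for q
      using P_add_orthogonal[OF r that] by (simp add: a_def p_def inner2_def)
  qed
  ultimately have Lambda_p: "ae_eq (Lambda_star K h n X R p) (P_add (?res (?S r_ll)))"
    using P_add_lincomb[OF y a, of 1] unfolding ae_eq_def Lambda_star_def y_def[symmetric]
    by eventually_elim simp
  define w where "w = op_inv F_add (Lambda_star K h n X R) (P_add (?res (?S r_ll)))"
  \<comment> \<open>\<open>p\<close> itself is a preimage, so the choice in \<open>op_inv\<close> is
    meaningful at this right-hand side.\<close>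
  have "\<exists>w. w \<in> F_add \<and> ae_eq (Lambda_star K h n X R w) (P_add (?res (?S r_ll)))"
    using p Lambda_p by blast
  from someI_ex[OF this, folded op_inv_def, folded w_def]
  have w: "w \<in> F_add" and Lambda_w: "ae_eq (Lambda_star K h n X R w) (P_add (?res (?S r_ll)))"
    by blast+
  have "ae_eq w p"
    by (rule Lambda_star_inj[OF K R assms(6) w p ae_eq_trans[OF Lambda_w ae_eq_sym[OF Lambda_p]]])
  then have P_star: "ae_eq (P_star K h n X R r_ll) p"
    unfolding P_star_def w_def[symmetric] by (rule ae_eq_trans[OF P_add_ident[OF w]])
  have "ae_eq a (?res (?S (\<lambda>x. r_ll x - P_star K h n X R r_ll x)))"
  proof (rule S_res_unique[OF K R])
    \<comment> \<open>\<open>r_L - S p\<close> serves as square integrable representative of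
      \<open>S (r_ll - P_star r_ll)\<close>; by the normal equation \<open>a\<close> solves the
      resolvent equation for it.\<close>
    show "(\<lambda>x. ?L x - ?S p x) \<in> F_full"
      by (intro F_full_diff r_L_full[OF K] S_star_full[OF K] F_add_subset[OF p])
    show "ae_eq (\<lambda>x. ?L x - ?S p x) (?S (\<lambda>x. r_ll x - P_star K h n X R r_ll x))"
      using ll P_star unfolding ae_eq_def S_star_def
      by eventually_elim (simp add: matrix_vector_mult_diff_distrib)
    show "ae_eq (\<lambda>x. ?S a x + R *\<^sub>R a x) (\<lambda>x. ?L x - ?S p x)"
      using normal unfolding ae_eq_def S_star_def
      by eventually_elim (simp add: a_def p_def[symmetric] matrix_vector_mult_diff_distrib algebra_simps)
  qed
  with P_star show ?thesis unfolding a_def p_def by (blast intro: ae_eq_sym)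
qed

end
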